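(* If $A$ is an orthomodular poset, then the hypergraph $\mathcal{G}(A)$ is completely determined by its points and lines. That is, if $A$ and $C$ are orthomodular posets and $\sigma$ is a bijection from the points of $\mathcal{G}(A)$ to the points of $\mathcal{G}(C)$ such that a set of points of $\mathcal{G}(A)$ is a line if and only if its image under $\sigma$ is a line of $\mathcal{G}(C)$, then a set of points of $\mathcal{G}(A)$ is a plane if and only if its image under $\sigma$ is a plane of $\mathcal{G}(C)$.
   Context: An orthoalgebra is a set $A$ with a partial binary operation $\oplus$ (write $a\perp b$ when $a\oplus b$ is defined), a unary operation $'$ and constants $0,1$ such that: (1) $\oplus$ is commutative and associative in the usual sense for partial operations; (2) $a'$ is the unique element with $a\oplus a'$ defined and equal to $1$; (3) $a\oplus a$ is defined iff $a=0$. It is partially ordered by $a\le c$ iff $a\oplus b=c$ for some $b\perp a$. An orthomodular poset is an orthoalgebra in which $a\oplus b$ is the join $a\vee b$ whenever $a\perp b$. An orthoalgebra is Boolean if it arises from a Boolean algebra by restricting the join to pairs of orthogonal elements. A subalgebra is a subset containing $0,1$, closed under $'$ and under $\oplus$ (when defined); a Boolean subalgebra is a subalgebra that is a Boolean orthoalgebra. $\mathrm{BSub}(A)$ is the poset of Boolean subalgebras under inclusion; its least element is $\{0,1\}$, of height $0$. The hypergraph $\mathcal{G}(A)=(P,L,T)$ of an orthoalgebra $A$ has as points (elements of $P$) the atoms of $\mathrm{BSub}(A)$; as lines (elements of $L$) the sets of three points that are the atoms below an element of height $2$ of $\mathrm{BSub}(A)$; as planes (elements of $T$) the sets of seven points that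 are the atoms below an element of height $3$ of $\mathrm{BSub}(A)$. *)

theory Defs
  imports Main "HOL-Library.Extended_Nat"
begin

text \<open>
  The partial sum is an \<^typ>\<open>'a option\<close>-valued operation: \<^term>\<open>None\<close> means ``undefined''.
  Only the behaviour of the operations on \<open>elems\<close> matters.
\<close>

record 'a orthoalg =
  elems :: "'a set"
  osum :: "'a \<Rightarrow> 'a \<Rightarrow> 'a option"
  ocompl :: "'a \<Rightarrow> 'a"
  ozero :: 'a
  oone :: 'a

definition perp :: "('a, 'm) orthoalg_scheme \<Rightarrow> 'a \<Rightarrow> 'a \<Rightarrow> bool" where
  "perp A a b \<longleftrightarrow> osum A a b \<noteq> None"

definition oa_le :: "('a, 'm) orthoalg_scheme \<Rightarrow> 'a \<Rightarrow> 'a \<Rightarrow> bool" where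
  "oa_le A a c \<longleftrightarrow> (\<exists>b\<in>elems A. osum A a b = Some c)"

text \<open>
  Associativity is Kleene equality: if either of \<open>a \<oplus> (b \<oplus> c)\<close> and \<open>(a \<oplus> b) \<oplus> c\<close> is
  defined then both are, and they agree.  The case \<open>0 = 1\<close> is not excluded (it forces
  a single element).
\<close>

locale orthoalgebra =
  fixes A :: "('a, 'm) orthoalg_scheme"
  assumes zero_closed: "ozero A \<in> elems A"
    and one_closed: "oone A \<in> elems A"
    and compl_closed: "a \<in> elems A \<Longrightarrow> ocompl A a \<in> elems A"
    and sum_closed:
      "\<lbrakk>a \<in> elems A; b \<in> elems A; osum A a b = Some c\<rbrakk> \<Longrightarrow> c \<in> elems A"
    and sum_commute:
      "\<lbrakk>a \<in> elems A; b \<in> elems A\<rbrakk> \<Longrightarrow> osum A a b = osum A b a"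
    and sum_assoc:
      "\<lbrakk>a \<in> elems A; b \<in> elems A; c \<in> elems A\<rbrakk> \<Longrightarrow>
        Option.bind (osum A b c) (\<lambda>s. osum A a s) = Option.bind (osum A a b) (\<lambda>s. osum A s c)"
    and sum_compl: "a \<in> elems A \<Longrightarrow> osum A a (ocompl A a) = Some (oone A)"
    and compl_unique:
      "\<lbrakk>a \<in> elems A; b \<in> elems A; osum A a b = Some (oone A)\<rbrakk> \<Longrightarrow> b = ocompl A a"
    and perp_self_iff: "a \<in> elems A \<Longrightarrow> perp A a a \<longleftrightarrow> a = ozero A"

locale orthomodular_poset = orthoalgebra +
  assumes sum_upper:
      "\<lbrakk>a \<in> elems A; b \<in> elems A; osum A a b = Some c\<rbrakk> \<Longrightarrow> oa_le A a c \<and> oa_le A b c"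
    and sum_least:
      "\<lbrakk>a \<in> elems A; b \<in> elems A; osum A a b = Some c;
        d \<in> elems A; oa_le A a d; oa_le A b d\<rbrakk> \<Longrightarrow> oa_le A c d"

text \<open>
  Boolean algebras with an explicit carrier; the axioms are those of
  \<^locale>\<open>abstract_boolean_algebra\<close>, relativised to the carrier.
\<close>

locale boolean_algebra_on =
  fixes B :: "'a set"
    and meet :: "'a \<Rightarrow> 'a \<Rightarrow> 'a"
    and join :: "'a \<Rightarrow> 'a \<Rightarrow> 'a"
    and compl :: "'a \<Rightarrow> 'a"
    and zero :: 'a
    and one :: 'a
  assumes ba_zero_closed: "zero \<in> B"
    and ba_one_closed: "one \<in> B"
    and ba_compl_closed: "x \<in> B \<Longrightarrow> compl x \<in> B"
    and ba_meet_closed: "\<lbrakk>x \<in> B; y \<in> B\<rbrakk> \<Longrightarrow> meet x y \<in> B"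
    and ba_join_closed: "\<lbrakk>x \<in> B; y \<in> B\<rbrakk> \<Longrightarrow> join x y \<in> B"
    and ba_meet_assoc:
      "\<lbrakk>x \<in> B; y \<in> B; z \<in> B\<rbrakk> \<Longrightarrow> meet (meet x y) z = meet x (meet y z)"
    and ba_join_assoc:
      "\<lbrakk>x \<in> B; y \<in> B; z \<in> B\<rbrakk> \<Longrightarrow> join (join x y) z = join x (join y z)"
    and ba_meet_commute: "\<lbrakk>x \<in> B; y \<in> B\<rbrakk> \<Longrightarrow> meet x y = meet y x"
    and ba_join_commute: "\<lbrakk>x \<in> B; y \<in> B\<rbrakk> \<Longrightarrow> join x y = join y x"
    and ba_meet_join_distrib:
      "\<lbrakk>x \<in> B; y \<in> B; z \<in> B\<rbrakk> \<Longrightarrow> meet x (join y z) = join (meet x y) (meet x z)"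
    and ba_join_meet_distrib:
      "\<lbrakk>x \<in> B; y \<in> B; z \<in> B\<rbrakk> \<Longrightarrow> join x (meet y z) = meet (join x y) (join x z)"
    and ba_meet_one: "x \<in> B \<Longrightarrow> meet x one = x"
    and ba_join_zero: "x \<in> B \<Longrightarrow> join x zero = x"
    and ba_meet_compl: "x \<in> B \<Longrightarrow> meet x (compl x) = zero"
    and ba_join_compl: "x \<in> B \<Longrightarrow> join x (compl x) = one"

definition boolean_orthoalgebra :: "('a, 'm) orthoalg_scheme \<Rightarrow> bool" where
  "boolean_orthoalgebra A \<longleftrightarrow> orthoalgebra A \<and>
    (\<exists>meet join.
      boolean_algebra_on (elems A) meet join (ocompl A) (ozero A) (oone A) \<and>
      (\<forall>a\<in>elems A. \<forall>b\<in>elems A.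
        osum A a b = (if meet a b = ozero A then Some (join a b) else None)))"

definition subalgebra :: "'a set \<Rightarrow> ('a, 'm) orthoalg_scheme \<Rightarrow> bool" where
  "subalgebra S A \<longleftrightarrow> S \<subseteq> elems A \<and> ozero A \<in> S \<and> oone A \<in> S \<and>
    (\<forall>a\<in>S. ocompl A a \<in> S) \<and>
    (\<forall>a\<in>S. \<forall>b\<in>S. \<forall>c. osum A a b = Some c \<longrightarrow> c \<in> S)"

definition BSub :: "('a, 'm) orthoalg_scheme \<Rightarrow> 'a set set" where
  "BSub A = {S. subalgebra S A \<and> boolean_orthoalgebra (A\<lparr>elems := S\<rparr>)}"

text \<open>
  Height of \<open>x\<close> in a family \<open>F\<close> of sets ordered by inclusion: the supremum of the lengths
  (number of members minus one) of the finite chains in the down-set of \<open>x\<close>.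
\<close>

definition height_in :: "'b set set \<Rightarrow> 'b set \<Rightarrow> enat" where
  "height_in F x =
    (SUP C \<in> {C. finite C \<and> subset.chain {y \<in> F. y \<subseteq> x} C}. enat (card C - 1))"

definition hg_points :: "('a, 'm) orthoalg_scheme \<Rightarrow> 'a set set" where
  "hg_points A = {p \<in> BSub A. p \<noteq> {ozero A, oone A} \<and>
    (\<forall>y\<in>BSub A. y \<subseteq> p \<longrightarrow> y = {ozero A, oone A} \<or> y = p)}"

definition hg_lines :: "('a, 'm) orthoalg_scheme \<Rightarrow> 'a set set set" where
  "hg_lines A = {l. card l = 3 \<and>
    (\<exists>x\<in>BSub A. height_in (BSub A) x = 2 \<and> l = {p \<in> hg_points A. p \<subseteq> x})}"

definition hg_planes :: "('a, 'm) orthoalg_scheme \<Rightarrow> 'a set set set" where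
  "hg_planes A = {t. card t = 7 \<and>
    (\<exists>x\<in>BSub A. height_in (BSub A) x = 3 \<and> t = {p \<in> hg_points A. p \<subseteq> x})}"

end

theory Submission
  imports Defs
begin

text \<open>
  The idea is to describe a plane by its lines alone.  An atom of the poset of Boolean subalgebras is
  \<open>{0, a, a', 1}\<close> for some \<open>a\<close> other than \<open>0\<close> and \<open>1\<close>; write \<open>pt a\<close> for it, so that
  \<open>pt a = pt a'\<close>.  A finite Boolean subalgebra consists of the joins of the subsets of its set of
  atoms, and these atoms form an orthogonal partition of the unit; conversely every
  finite orthogonal partition of the unit generates such a subalgebra (\<open>gen_BSub\<close>,
  \<open>finite_BSub_gen\<close>).  With \<open>n + 1\<close> atoms the subalgebra has height \<open>n\<close> and contains
  \<open>2 ^ n - 1\<close> points.  Hence a line is the set of points of a partition into three parts, and a plane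
  is the set of points below the subalgebra of a partition into four parts \<open>a, b, c, d\<close>
  (\<open>hg_lines_eq\<close>, \<open>hg_planes_eq\<close>).

  Such a plane consists of \<open>pt a, pt b, pt c, pt d\<close> and the three points
  \<open>pt (a \<oplus> b) = pt (c \<oplus> d)\<close>, \<open>pt (a \<oplus> c) = pt (b \<oplus> d)\<close> and \<open>pt (b \<oplus> c) = pt (a \<oplus> d)\<close>.  The triangle
  \<open>pt a, pt b, pt c\<close> has the first, second and third of these as the third points on its sides, and
  \<open>pt d\<close> lies on the line through \<open>pt a\<close> and the third point of the opposite side.  This is the
  configuration \<open>plane_figure\<close>, expressed by incidences of points and lines.

  Conversely, any seven points in this configuration form a plane.  Let \<open>p, q, r\<close> be a triangle, that
  is, three points any two of which are on a line, but which are not on a common line.  Each of the three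
  lines picks one of the two elements representing each of its points, and the elements it picks are
  orthogonal.  If the two lines through a point agree at all three points, then
  \<open>p, q, r\<close> are given by pairwise orthogonal elements; if they
  disagree at exactly one point, then by elements with \<open>x \<le> y \<bottom> z\<close>; and disagreement at two or three
  points is contradictory.  In the first two cases the three points are in the subalgebra of a
  partition into four parts (\<open>triangle_partition\<close>).  It is the first case that fails in orthoalgebras at
  large: in an orthomodular poset \<open>x \<oplus> y\<close> is the join of \<open>x\<close> and \<open>y\<close>, and is therefore orthogonal to
  everything orthogonal to both of them.  A subalgebra containing two points of a line contains the
  third, which puts the other four points in the same subalgebra, and counting
  finishes the argument.  A bijection that respects lines respects \<open>plane_figure\<close>.
\<close>

section \<open>Order in an orthoalgebra\<close>

context orthoalgebra
begin

abbreviation leq (infix "\<preceq>" 50) where "a \<preceq> b \<equiv> oa_le A a b"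
abbreviation orth (infix "\<bottom>" 50) where "a \<bottom> b \<equiv> perp A a b"
abbreviation cmp where "cmp \<equiv> ocompl A"
abbreviation zero_elem ("\<zero>") where "\<zero> \<equiv> ozero A"
abbreviation one_elem ("\<one>") where "\<one> \<equiv> oone A"

lemmas closed = zero_closed one_closed compl_closed

lemma perp_sym: "\<lbrakk>a \<in> elems A; b \<in> elems A; a \<bottom> b\<rbrakk> \<Longrightarrow> b \<bottom> a"
  by (simp add: perp_def sum_commute)

lemma perpE:
  assumes "a \<in> elems A" "b \<in> elems A" "a \<bottom> b"
  obtains s where "s \<in> elems A" "osum A a b = Some s" "osum A b a = Some s"
proof -
  obtain s where s: "osum A a b = Some s" using assms(3) by (auto simp: perp_def)
  then have "osum A b a = Some s" using sum_commute[OF assms(1,2)] by simp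
  then show ?thesis using that sum_closed[OF assms(1,2) s] s by blast
qed

lemma sum_assoc_left:
  assumes "a \<in> elems A" "b \<in> elems A" "c \<in> elems A" "osum A a b = Some s" "osum A s c = Some t"
  obtains r where "r \<in> elems A" "osum A b c = Some r" "osum A a r = Some t"
proof -
  have "Option.bind (osum A b c) (\<lambda>s. osum A a s) = Some t"
    by (simp add: sum_assoc[OF assms(1-3)] assms(4,5))
  then obtain r where r: "osum A b c = Some r" "osum A a r = Some t"
    by (auto simp: bind_eq_Some_conv)
  show ?thesis by (rule that[OF sum_closed[OF assms(2,3) r(1)] r])
qed

lemma sum_assoc_right:
  assumes "a \<in> elems A" "b \<in> elems A" "c \<in> elems A" "osum A b c = Some s" "osum A a s = Some t"
  obtains r where "r \<in> elems A" "osum A a b = Some r" "osum A r c = Some t"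
proof -
  have "Option.bind (osum A a b) (\<lambda>s. osum A s c) = Some t"
    by (simp add: sum_assoc[OF assms(1-3), symmetric] assms(4,5))
  then obtain r where r: "osum A a b = Some r" "osum A r c = Some t"
    by (auto simp: bind_eq_Some_conv)
  show ?thesis by (rule that[OF sum_closed[OF assms(1,2) r(1)] r])
qed

text \<open>If \<open>1 \<bottom> a\<close>, then \<open>(a' \<oplus> a) \<oplus> a\<close> is defined, and by associativity so is \<open>a \<oplus> a\<close>.\<close>

lemma perp_one_imp_zero:
  assumes "a \<in> elems A" "\<one> \<bottom> a" shows "a = \<zero>"
proof -
  obtain t where t: "osum A \<one> a = Some t" using assms by (auto simp: perp_def)
  have "osum A (cmp a) a = Some \<one>" using assms sum_compl closed sum_commute by metis
  then obtain r where "osum A a a = Some r"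
    using sum_assoc_left[OF _ _ _ _ t] assms closed by metis
  then show ?thesis using perp_self_iff assms by (auto simp: perp_def)
qed

lemma compl_one: "cmp \<one> = \<zero>"
  using perp_one_imp_zero[of "cmp \<one>"] sum_compl[OF one_closed] closed by (auto simp: perp_def)

lemma compl_compl: "a \<in> elems A \<Longrightarrow> cmp (cmp a) = a"
  using compl_unique[of "cmp a" a] closed sum_compl sum_commute by metis

lemma compl_zero: "cmp \<zero> = \<one>"
  using compl_compl[OF one_closed] compl_one by simp

text \<open>Both \<open>a\<close> and \<open>a \<oplus> 0\<close> are complements of \<open>a'\<close>, since \<open>(a' \<oplus> a) \<oplus> 0 = 1 \<oplus> 0 = 1\<close>.\<close>

lemma sum_zero: assumes "a \<in> elems A" shows "osum A a \<zero> = Some a"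
proof -
  have 1: "osum A (cmp (cmp a)) (cmp a) = Some \<one>"
    using sum_compl[of "cmp a"] sum_commute closed assms by metis
  have 2: "osum A \<one> \<zero> = Some \<one>" using sum_compl[OF one_closed] compl_one by simp
  have "osum A (cmp a) a = Some \<one>" using sum_compl sum_commute closed assms by metis
  then obtain r where r: "r \<in> elems A" "osum A a \<zero> = Some r" "osum A (cmp a) r = Some \<one>"
    using sum_assoc_left[OF _ _ _ _ 2] assms closed by metis
  then have "r = cmp (cmp a)" using compl_unique closed assms by blast
  then show ?thesis using r compl_compl assms by simp
qed

text \<open>If \<open>b = a \<oplus> c\<close>, reassociate \<open>(c \<oplus> a) \<oplus> b'\<close>.  Conversely the complement \<open>t\<close> of \<open>a \<oplus> b'\<close>
  satisfies \<open>b' \<oplus> (a \<oplus> t) = 1\<close>, so that \<open>a \<oplus> t = b\<close> by uniqueness of complements.\<close>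

lemma le_iff_perp_compl:
  assumes "a \<in> elems A" "b \<in> elems A" shows "a \<preceq> b \<longleftrightarrow> a \<bottom> cmp b"
proof
  assume "a \<preceq> b"
  then obtain c where c: "c \<in> elems A" "osum A a c = Some b" by (auto simp: oa_le_def)
  then have "osum A c a = Some b" using sum_commute assms by metis
  from sum_assoc_left[OF c(1) assms(1) _ this sum_compl[OF assms(2)]] closed assms
  show "a \<bottom> cmp b" by (metis option.distinct(1) perp_def)
next
  assume "a \<bottom> cmp b"
  then obtain s where s: "osum A (cmp b) a = Some s" "s \<in> elems A"
    using perpE[of a "cmp b"] closed assms by blast
  obtain r where r: "r \<in> elems A" "osum A a (cmp s) = Some r" "osum A (cmp b) r = Some \<one>"
    using sum_assoc_left[OF _ _ _ s(1) sum_compl[OF s(2)]] assms closed s by metis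
  then have "r = b" using compl_unique[of "cmp b" r] compl_compl closed assms by metis
  then show "a \<preceq> b" using r s closed by (auto simp: oa_le_def)
qed

lemma le_compl_iff_perp:
  assumes "a \<in> elems A" "b \<in> elems A" shows "a \<preceq> cmp b \<longleftrightarrow> a \<bottom> b"
  using le_iff_perp_compl[of a "cmp b"] assms closed compl_compl by simp

lemma le_refl: "a \<in> elems A \<Longrightarrow> a \<preceq> a"
  using sum_zero closed by (auto simp: oa_le_def)

lemma zero_le: "a \<in> elems A \<Longrightarrow> \<zero> \<preceq> a"
  using sum_zero closed sum_commute unfolding oa_le_def by metis

lemma le_one: "a \<in> elems A \<Longrightarrow> a \<preceq> \<one>"
  using sum_compl closed unfolding oa_le_def by metis

lemma le_trans:
  assumes "a \<in> elems A" "b \<in> elems A" "c \<in> elems A" "a \<preceq> b" "b \<preceq> c" shows "a \<preceq> c"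
proof -
  obtain x y where x: "x \<in> elems A" "osum A a x = Some b" and y: "y \<in> elems A" "osum A b y = Some c"
    using assms by (auto simp: oa_le_def)
  show ?thesis using sum_assoc_left[OF assms(1) x(1) y(1) x(2) y(2)] by (auto simp: oa_le_def)
qed

lemma le_zero: assumes "a \<in> elems A" "a \<preceq> \<zero>" shows "a = \<zero>"
  using le_iff_perp_compl[OF assms(1) zero_closed] assms compl_zero perp_one_imp_zero perp_sym closed
  by metis

text \<open>Going up from \<open>a\<close> to \<open>b\<close> and back adds some \<open>d\<close> with \<open>a \<oplus> d = a\<close>; adding \<open>a'\<close> shows \<open>1 \<bottom> d\<close>.\<close>

lemma le_antisym:
  assumes "a \<in> elems A" "b \<in> elems A" "a \<preceq> b" "b \<preceq> a" shows "a = b"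
proof -
  obtain x y where x: "x \<in> elems A" "osum A a x = Some b" and y: "y \<in> elems A" "osum A b y = Some a"
    using assms by (auto simp: oa_le_def)
  obtain d where d: "d \<in> elems A" "osum A x y = Some d" "osum A a d = Some a"
    using sum_assoc_left[OF assms(1) x(1) y(1) x(2) y(2)] .
  have 1: "osum A (cmp a) a = Some \<one>" using sum_compl sum_commute closed assms by metis
  then have "osum A \<one> d = Some \<one>"
    using sum_assoc_right[OF _ _ _ d(3) 1] assms closed d 1 by (metis option.inject)
  then have "d = \<zero>" using perp_one_imp_zero d by (auto simp: perp_def)
  then have "x = \<zero>" using d x y le_zero by (auto simp: oa_le_def)
  then show ?thesis using x sum_zero assms by simp
qed

lemma perp_mono:
  assumes "a \<in> elems A" "b \<in> elems A" "c \<in> elems A" "a \<preceq> b" "b \<bottom> c" shows "a \<bottom> c"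
  using assms le_trans[of a b "cmp c"] le_compl_iff_perp closed by metis

lemma le_perp_zero:
  assumes "a \<in> elems A" "b \<in> elems A" "a \<preceq> b" "a \<bottom> b" shows "a = \<zero>"
  using assms perp_mono[of a b a] perp_sym perp_self_iff by metis

lemma compl_antimono:
  assumes "a \<in> elems A" "b \<in> elems A" "a \<preceq> b" shows "cmp b \<preceq> cmp a"
  using assms le_iff_perp_compl le_compl_iff_perp perp_sym closed by metis

lemma compl_eq_zero_iff: "a \<in> elems A \<Longrightarrow> cmp a = \<zero> \<longleftrightarrow> a = \<one>"
  using compl_compl compl_one compl_zero by metis

lemma compl_eq_one_iff: "a \<in> elems A \<Longrightarrow> cmp a = \<one> \<longleftrightarrow> a = \<zero>"
  using compl_compl compl_one compl_zero by metis

lemma perp_compl: "a \<in> elems A \<Longrightarrow> a \<bottom> cmp a"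
  using sum_compl by (auto simp: perp_def)

lemma compl_neq: "\<lbrakk>a \<in> elems A; a \<noteq> \<zero>\<rbrakk> \<Longrightarrow> cmp a \<noteq> a"
  using perp_self_iff perp_compl by metis

section \<open>Restriction to a subalgebra\<close>

lemma subalgebraD:
  assumes "subalgebra S A"
  shows "S \<subseteq> elems A" "\<zero> \<in> S" "\<one> \<in> S" "a \<in> S \<Longrightarrow> cmp a \<in> S"
    "\<lbrakk>a \<in> S; b \<in> S; osum A a b = Some c\<rbrakk> \<Longrightarrow> c \<in> S"
  using assms unfolding subalgebra_def by blast+

lemma subalgebra_orthoalgebra:
  assumes "subalgebra S A" shows "orthoalgebra (A\<lparr>elems := S\<rparr>)"
proof -
  note S = subalgebraD[OF assms]
  show ?thesis
  proof
    fix a b c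
    assume abc: "a \<in> elems (A\<lparr>elems := S\<rparr>)" "b \<in> elems (A\<lparr>elems := S\<rparr>)" "c \<in> elems (A\<lparr>elems := S\<rparr>)"
    then have e: "a \<in> elems A" "b \<in> elems A" "c \<in> elems A" using S(1) by auto
    show "Option.bind (osum (A\<lparr>elems := S\<rparr>) b c) (\<lambda>s. osum (A\<lparr>elems := S\<rparr>) a s)
      = Option.bind (osum (A\<lparr>elems := S\<rparr>) a b) (\<lambda>s. osum (A\<lparr>elems := S\<rparr>) s c)"
      using sum_assoc[OF e] by simp
  next
    fix a b
    assume "a \<in> elems (A\<lparr>elems := S\<rparr>)" "b \<in> elems (A\<lparr>elems := S\<rparr>)"
    then have e: "a \<in> elems A" "b \<in> elems A" using S(1) by auto
    show "osum (A\<lparr>elems := S\<rparr>) a b = osum (A\<lparr>elems := S\<rparr>) b a" using sum_commute[OF e] by simp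
    show "osum (A\<lparr>elems := S\<rparr>) a b = Some (oone (A\<lparr>elems := S\<rparr>)) \<Longrightarrow> b = ocompl (A\<lparr>elems := S\<rparr>) a"
      using compl_unique[OF e] by simp
  next
    fix a
    assume "a \<in> elems (A\<lparr>elems := S\<rparr>)"
    then have e: "a \<in> elems A" using S(1) by auto
    show "osum (A\<lparr>elems := S\<rparr>) a (ocompl (A\<lparr>elems := S\<rparr>) a) = Some (oone (A\<lparr>elems := S\<rparr>))"
      using sum_compl[OF e] by simp
    show "perp (A\<lparr>elems := S\<rparr>) a a \<longleftrightarrow> a = ozero (A\<lparr>elems := S\<rparr>)"
      using perp_self_iff[OF e] by (simp add: perp_def)
  next
    fix a b c
    assume "a \<in> elems (A\<lparr>elems := S\<rparr>)" "b \<in> elems (A\<lparr>elems := S\<rparr>)" "osum (A\<lparr>elems := S\<rparr>) a b = Some c"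
    then show "c \<in> elems (A\<lparr>elems := S\<rparr>)" using S(5)[of a b c] by simp
  qed (simp_all add: S(2-4))
qed

text \<open>The meet \<open>m\<close> of \<open>x\<close> and \<open>y\<close> splits off from both, leaving \<open>n\<close> and \<open>k\<close>.  Stated with the partial sum
  only, this is the form in which Booleanness can be used inside the surrounding orthoalgebra.\<close>

lemma BSub_compatible:
  assumes "S \<in> BSub A" "x \<in> S" "y \<in> S"
  obtains m n k where "m \<in> S" "n \<in> S" "k \<in> S" "osum A m n = Some x" "osum A m k = Some y" "n \<bottom> y"
proof -
  obtain meet join where B: "boolean_algebra_on S meet join cmp \<zero> \<one>"
    and s: "\<forall>a\<in>S. \<forall>b\<in>S. osum A a b = (if meet a b = \<zero> then Some (join a b) else None)"
    using assms by (auto simp: BSub_def boolean_orthoalgebra_def)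
  interpret boolean_algebra_on S meet join cmp \<zero> \<one> by fact
  have meet0: "meet u \<zero> = \<zero>" if "u \<in> S" for u
  proof -
    have "meet u \<zero> = meet u (meet u (cmp u))" using that ba_meet_compl by simp
    also have "\<dots> = meet (meet u u) (cmp u)" using that ba_meet_assoc ba_compl_closed by simp
    also have "meet u u = u"
    proof -
      have "meet u u = join (meet u u) (meet u (cmp u))"
        using that ba_meet_compl ba_join_zero ba_meet_closed by simp
      also have "\<dots> = u"
        using that ba_meet_join_distrib[of u u "cmp u"] ba_join_compl ba_meet_one ba_compl_closed by simp
      finally show ?thesis .
    qed
    finally show ?thesis using that ba_meet_compl by simp
  qed
  have key: "osum A (meet u v) (meet u (cmp v)) = Some u" if "u \<in> S" "v \<in> S" for u v
  proof -
    have c: "cmp v \<in> S" using that ba_compl_closed by simp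
    have "meet v (meet u (cmp v)) = meet u (meet v (cmp v))"
      using ba_meet_assoc[of v u "cmp v"] ba_meet_assoc[of u v "cmp v"] ba_meet_commute[of u v] that c
      by simp
    then have "meet v (meet u (cmp v)) = \<zero>" using that meet0 ba_meet_compl by simp
    then have "meet (meet u v) (meet u (cmp v)) = \<zero>"
      using ba_meet_assoc[of u v "meet u (cmp v)"] that c meet0 ba_meet_closed by simp
    moreover have "join (meet u v) (meet u (cmp v)) = u"
      using ba_meet_join_distrib[of u v "cmp v"] that c ba_join_compl ba_meet_one by simp
    ultimately show ?thesis using s that ba_meet_closed ba_compl_closed by simp
  qed
  have "meet (meet x (cmp y)) y = meet x (meet y (cmp y))"
    using ba_meet_assoc[of x "cmp y" y] ba_meet_commute[of y "cmp y"] assms ba_compl_closed by simp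
  then have "meet (meet x (cmp y)) y = \<zero>" using assms meet0 ba_meet_compl by simp
  then have "meet x (cmp y) \<bottom> y"
    using s assms ba_meet_closed ba_compl_closed by (simp add: perp_def)
  moreover have "osum A (meet x y) (meet y (cmp x)) = Some y"
    using key[of y x] assms ba_meet_commute by simp
  ultimately show ?thesis
    using that[of "meet x y" "meet x (cmp y)" "meet y (cmp x)"] key[of x y] assms
      ba_meet_closed ba_compl_closed by blast
qed

end

section \<open>Orthogonal partitions of the unit and finite Boolean subalgebras\<close>

context orthomodular_poset
begin

lemma sum_ge:
  assumes "a \<in> elems A" "b \<in> elems A" "osum A a b = Some c"
  shows "a \<preceq> c" "b \<preceq> c"
  using sum_upper[OF assms] by simp_all

definition is_lub :: "'a set \<Rightarrow> 'a \<Rightarrow> bool" where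
  "is_lub J s \<longleftrightarrow> s \<in> elems A \<and> (\<forall>e\<in>J. e \<preceq> s) \<and> (\<forall>d\<in>elems A. (\<forall>e\<in>J. e \<preceq> d) \<longrightarrow> s \<preceq> d)"

definition osup :: "'a set \<Rightarrow> 'a" where
  "osup J = (THE s. is_lub J s)"

lemma osup_eqI: "is_lub J s \<Longrightarrow> osup J = s"
  unfolding osup_def using le_antisym by (intro the_equality) (auto simp: is_lub_def)

text \<open>In an orthomodular poset the orthogonal sum is a join, so lubs of orthogonal families can be formed
  one element at a time, and they need not be described as iterated sums.\<close>

lemma is_lub_insert:
  assumes e: "e \<in> elems A" and s: "is_lub J s" and "J \<subseteq> elems A" and p: "\<forall>x\<in>J. x \<bottom> e"
    and t: "osum A e s = Some t"
  shows "is_lub (insert e J) t"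
proof -
  have sA: "s \<in> elems A" using s by (simp add: is_lub_def)
  have tA: "t \<in> elems A" using sum_closed[OF e sA t] .
  have "x \<preceq> t" if "x \<in> J" for x
    using le_trans[of x s t] that s sA tA assms(3) sum_ge[OF e sA t] by (auto simp: is_lub_def)
  moreover have "t \<preceq> d" if "d \<in> elems A" "\<forall>x\<in>insert e J. x \<preceq> d" for d
    using sum_least[OF e sA t that(1)] that s by (simp add: is_lub_def)
  ultimately show ?thesis using sum_ge[OF e sA t] tA by (simp add: is_lub_def)
qed

text \<open>Elements orthogonal to \<open>e\<close> are those below \<open>e'\<close>, so the lub of a family orthogonal to \<open>e\<close> is again
  orthogonal to \<open>e\<close> and the next sum is defined.\<close>

lemma osup_is_lub:
  assumes "finite J" "J \<subseteq> elems A" "pairwise (perp A) J"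
  shows "is_lub J (osup J)"
proof -
  have "\<exists>s. is_lub J s" using assms
  proof induction
    case empty
    then show ?case using zero_le closed by (auto simp: is_lub_def)
  next
    case (insert e F)
    have e: "e \<in> elems A" "F \<subseteq> elems A" "pairwise (perp A) F" using insert.prems
      by (auto simp: pairwise_insert)
    then obtain s where s: "is_lub F s" using insert by blast
    have p: "\<forall>x\<in>F. x \<bottom> e" using insert by (auto simp: pairwise_insert)
    then have "\<forall>x\<in>F. x \<preceq> cmp e" using le_compl_iff_perp e by blast
    then have "s \<preceq> cmp e" using s e closed by (simp add: is_lub_def)
    have sA: "s \<in> elems A" using s by (simp add: is_lub_def)
    then have "s \<bottom> e" using le_compl_iff_perp e \<open>s \<preceq> cmp e\<close> by blast
    then obtain t where "osum A e s = Some t" using perpE[OF sA e(1)] by blast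
    then show ?case using is_lub_insert e s p by blast
  qed
  then show ?thesis using osup_eqI by blast
qed

text \<open>These are the sets of atoms of finite Boolean subalgebras.  The empty set qualifies when \<open>0 = 1\<close>.\<close>

definition unit_partition :: "'a set \<Rightarrow> bool" where
  "unit_partition E \<longleftrightarrow> finite E \<and> E \<subseteq> elems A - {\<zero>} \<and> pairwise (perp A) E \<and> is_lub E \<one>"

definition gen :: "'a set \<Rightarrow> 'a set" where
  "gen E = osup ` Pow E"

context
  fixes E assumes E: "unit_partition E"
begin

lemma unit_partition_finite: "finite E"
  using E by (simp add: unit_partition_def)

lemma unit_partition_elems: "e \<in> E \<Longrightarrow> e \<in> elems A" "e \<in> E \<Longrightarrow> e \<noteq> \<zero>"
  using E by (auto simp: unit_partition_def)

lemma lub_part: "J \<subseteq> E \<Longrightarrow> is_lub J (osup J)"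
  using E finite_subset[of J E] pairwise_subset[of "perp A" E J]
  by (intro osup_is_lub) (auto simp: unit_partition_def)

lemma osup_closed: "J \<subseteq> E \<Longrightarrow> osup J \<in> elems A"
  using lub_part by (simp add: is_lub_def)

lemma osup_upper: "\<lbrakk>J \<subseteq> E; e \<in> J\<rbrakk> \<Longrightarrow> e \<preceq> osup J"
  using lub_part by (simp add: is_lub_def)

lemma osup_least: "\<lbrakk>J \<subseteq> E; d \<in> elems A; \<And>e. e \<in> J \<Longrightarrow> e \<preceq> d\<rbrakk> \<Longrightarrow> osup J \<preceq> d"
  using lub_part by (simp add: is_lub_def)

lemma perp_osup:
  assumes "K \<subseteq> E" "a \<in> elems A" "\<And>f. f \<in> K \<Longrightarrow> f \<bottom> a" shows "osup K \<bottom> a"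
proof -
  have "f \<preceq> cmp a" if "f \<in> K" for f
    using le_compl_iff_perp[of f a] unit_partition_elems(1)[of f] assms that by blast
  then have "osup K \<preceq> cmp a" by (rule osup_least[OF assms(1) compl_closed[OF assms(2)]])
  then show ?thesis using le_compl_iff_perp[OF osup_closed[OF assms(1)] assms(2)] by simp
qed

lemma osup_perp: assumes "J \<subseteq> E" "K \<subseteq> E" "J \<inter> K = {}" shows "osup J \<bottom> osup K"
proof (rule perp_osup[OF assms(1) osup_closed[OF assms(2)]])
  fix e assume e: "e \<in> J"
  then have eA: "e \<in> elems A" using assms(1) unit_partition_elems by blast
  have "osup K \<bottom> e"
  proof (rule perp_osup[OF assms(2) eA])
    fix f assume "f \<in> K"
    then have "f \<noteq> e" "f \<in> E" "e \<in> E" using e assms by blast+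
    then show "f \<bottom> e" using E by (simp add: unit_partition_def pairwise_def)
  qed
  then show "e \<bottom> osup K" using perp_sym[OF osup_closed[OF assms(2)] eA] by simp
qed

lemma osup_mono:
  assumes "J \<subseteq> K" "K \<subseteq> E" shows "osup J \<preceq> osup K"
proof (rule osup_least[OF _ osup_closed[OF assms(2)]])
  show "e \<preceq> osup K" if "e \<in> J" for e using that osup_upper[OF assms(2), of e] assms by blast
qed (use assms in blast)

lemma osup_sum:
  assumes "J \<subseteq> E" "K \<subseteq> E" "J \<inter> K = {}"
  shows "osum A (osup J) (osup K) = Some (osup (J \<union> K))"
proof -
  note c = osup_closed[OF assms(1)] osup_closed[OF assms(2)]
  obtain t where t: "t \<in> elems A" "osum A (osup J) (osup K) = Some t"
    using perpE[OF c osup_perp[OF assms]] by blast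
  have "osup (J \<union> K) \<preceq> t"
  proof (rule osup_least)
    fix e assume "e \<in> J \<union> K"
    then have "e \<in> elems A" "e \<preceq> osup J \<or> e \<preceq> osup K"
      using osup_upper[OF assms(1), of e] osup_upper[OF assms(2), of e] assms unit_partition_elems by blast+
    then show "e \<preceq> t"
      using sum_ge[OF c t(2)] le_trans[of e "osup J" t] le_trans[of e "osup K" t] c t(1) by blast
  qed (use assms t in auto)
  moreover have "t \<preceq> osup (J \<union> K)"
    using sum_least[OF c t(2), of "osup (J \<union> K)"] osup_mono[of J "J \<union> K"] osup_mono[of K "J \<union> K"]
      osup_closed[of "J \<union> K"] assms by simp
  ultimately have "osup (J \<union> K) = t" using le_antisym osup_closed t(1) assms by simp
  then show ?thesis using t by simp
qed

text \<open>A common element of \<open>J\<close> and \<open>K\<close> would be orthogonal to itself, hence zero.\<close>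

lemma osup_perp_iff: assumes "J \<subseteq> E" "K \<subseteq> E" shows "osup J \<bottom> osup K \<longleftrightarrow> J \<inter> K = {}"
proof
  assume p: "osup J \<bottom> osup K"
  show "J \<inter> K = {}"
  proof (rule ccontr)
    assume "J \<inter> K \<noteq> {}"
    then obtain e where e: "e \<in> J" "e \<in> K" by blast
    then have eA: "e \<in> elems A" "e \<noteq> \<zero>" using unit_partition_elems assms by blast+
    have "e \<bottom> osup K"
      using perp_mono[of e "osup J" "osup K"] eA osup_closed assms osup_upper[of J e] e p by simp
    then show False
      using le_perp_zero[of e "osup K"] eA osup_closed assms osup_upper[of K e] e by simp
  qed
qed (use osup_perp[OF assms] in simp)

lemma osup_empty: "osup {} = \<zero>"
  by (rule osup_eqI) (use zero_le closed in \<open>auto simp: is_lub_def\<close>)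

lemma osup_singleton: "e \<in> E \<Longrightarrow> osup {e} = e"
  by (rule osup_eqI) (use unit_partition_elems le_refl in \<open>auto simp: is_lub_def\<close>)

lemma osup_whole: "osup E = \<one>"
  by (rule osup_eqI) (use E in \<open>simp add: unit_partition_def\<close>)

lemma osup_compl: assumes "J \<subseteq> E" shows "osup (E - J) = cmp (osup J)"
proof -
  have "J \<union> (E - J) = E" using assms by auto
  then show ?thesis
    using compl_unique[of "osup J" "osup (E - J)"] osup_sum[of J "E - J"] osup_closed assms osup_whole by simp
qed

text \<open>If \<open>J\<close> and \<open>K\<close> have the same join, then that join is orthogonal to the join of \<open>E - K\<close>, so \<open>J\<close> is
  disjoint from \<open>E - K\<close>.\<close>

lemma osup_inj: "inj_on osup (Pow E)"
proof -
  have *: "J \<subseteq> K" if "J \<subseteq> E" "K \<subseteq> E" "osup J = osup K" for J K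
  proof -
    have "osup J \<bottom> osup (E - K)" using that osup_perp_iff[of K "E - K"] by auto
    then have "J \<inter> (E - K) = {}" using osup_perp_iff[of J "E - K"] that by auto
    then show ?thesis using that by blast
  qed
  show ?thesis by (intro inj_onI subset_antisym; rule *) simp_all
qed

lemma osup_eq_iff: "\<lbrakk>J \<subseteq> E; K \<subseteq> E\<rbrakk> \<Longrightarrow> osup J = osup K \<longleftrightarrow> J = K"
  using osup_inj by (auto simp: inj_on_def)

lemma card_gen: "card (gen E) = 2 ^ card E"
  using card_image[OF osup_inj] card_Pow[OF unit_partition_finite] by (simp add: gen_def)

lemma gen_subalgebra: "subalgebra (gen E) A"
proof -
  have "osup J \<in> gen E" if "J \<subseteq> E" for J using that by (auto simp: gen_def)
  note g = this
  have "c \<in> gen E" if "J \<subseteq> E" "K \<subseteq> E" "osum A (osup J) (osup K) = Some c" for J K c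
  proof -
    have "J \<inter> K = {}" using that osup_perp_iff[of J K] by (simp add: perp_def)
    then have "c = osup (J \<union> K)" using osup_sum[of J K] that by simp
    then show ?thesis using g that by simp
  qed
  moreover have "cmp (osup J) \<in> gen E" if "J \<subseteq> E" for J
    using osup_compl[OF that] g[of "E - J"] by auto
  moreover have "\<zero> \<in> gen E" "\<one> \<in> gen E" using g[of "{}"] g[of E] osup_empty osup_whole by auto
  moreover have "gen E \<subseteq> elems A" using osup_closed by (auto simp: gen_def)
  ultimately show ?thesis unfolding subalgebra_def by (simp add: gen_def)
qed

text \<open>The Boolean structure is transported from the power set of \<open>E\<close> along the injection \<open>osup\<close>, which turns
  disjointness into orthogonality and disjoint union into the partial sum.\<close>

lemma gen_BSub: "gen E \<in> BSub A"
proof -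
  define g where "g = the_inv_into (Pow E) osup"
  define meet where "meet x y = osup (g x \<inter> g y)" for x y
  define join where "join x y = osup (g x \<union> g y)" for x y
  have g: "g (osup J) = J" if "J \<subseteq> E" for J
    using the_inv_into_f_f[OF osup_inj] that by (simp add: g_def)
  have m: "meet (osup J) (osup K) = osup (J \<inter> K)" if "J \<subseteq> E" "K \<subseteq> E" for J K
    using g that by (simp add: meet_def)
  have j: "join (osup J) (osup K) = osup (J \<union> K)" if "J \<subseteq> E" "K \<subseteq> E" for J K
    using g that by (simp add: join_def)
  have I: "J \<inter> K \<subseteq> E" if "J \<subseteq> E" for J K using that by blast
  note sub = subalgebraD[OF gen_subalgebra]
  have "boolean_algebra_on (gen E) meet join cmp \<zero> \<one>"
  proof
    fix x y assume "x \<in> gen E" "y \<in> gen E"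
    then obtain J K where JK: "x = osup J" "y = osup K" "J \<subseteq> E" "K \<subseteq> E" by (auto simp: gen_def)
    show "meet x y \<in> gen E" "join x y \<in> gen E" using JK m j by (auto simp: gen_def)
    show "meet x y = meet y x" "join x y = join y x" using JK m j by (simp_all add: ac_simps)
  next
    fix x y z assume "x \<in> gen E" "y \<in> gen E" "z \<in> gen E"
    then obtain J K L where JK: "x = osup J" "y = osup K" "z = osup L" "J \<subseteq> E" "K \<subseteq> E" "L \<subseteq> E"
      by (auto simp: gen_def)
    show "meet (meet x y) z = meet x (meet y z)" using JK by (simp add: m I Int_assoc)
    show "join (join x y) z = join x (join y z)" using JK by (simp add: j Un_assoc)
    show "meet x (join y z) = join (meet x y) (meet x z)" using JK by (simp add: m j I Int_Un_distrib)
    show "join x (meet y z) = meet (join x y) (join x z)" using JK by (simp add: m j I Un_Int_distrib)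
  next
    fix x assume "x \<in> gen E"
    then obtain J where J: "x = osup J" "J \<subseteq> E" by (auto simp: gen_def)
    have "J \<inter> E = J" "J \<union> (E - J) = E" using J by auto
    then show "meet x \<one> = x" "join x \<zero> = x" "meet x (cmp x) = \<zero>" "join x (cmp x) = \<one>"
      using J m[of J E] j[of J "{}"] m[of J "E - J"] j[of J "E - J"] osup_empty osup_whole osup_compl[of J]
      by auto
  qed (use sub(2-4) in blast)+
  moreover have "osum A a b = (if meet a b = \<zero> then Some (join a b) else None)"
    if ab: "a \<in> gen E" "b \<in> gen E" for a b
  proof -
    obtain J K where JK: "a = osup J" "b = osup K" "J \<subseteq> E" "K \<subseteq> E" using ab by (auto simp: gen_def)
    have "meet a b = \<zero> \<longleftrightarrow> J \<inter> K = {}"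
      using JK m osup_eq_iff[of "J \<inter> K" "{}"] osup_empty by auto
    then show ?thesis using JK j osup_sum[of J K] osup_perp_iff[of J K] by (auto simp: perp_def)
  qed
  ultimately have "boolean_orthoalgebra (A\<lparr>elems := gen E\<rparr>)"
    unfolding boolean_orthoalgebra_def using subalgebra_orthoalgebra[OF gen_subalgebra] by auto
  then show ?thesis using gen_subalgebra by (simp add: BSub_def)
qed

lemma osup_in_subalgebra:
  assumes "subalgebra S A" "J \<subseteq> E" "J \<subseteq> S" shows "osup J \<in> S"
proof -
  note sub = subalgebraD[OF assms(1)]
  have "finite J" using assms unit_partition_finite finite_subset by blast
  then show ?thesis using assms(2,3)
  proof induction
    case empty
    then show ?case using osup_empty sub(2) by simp
  next
    case (insert e J)
    then have "osum A e (osup J) = Some (osup (insert e J))"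
      using osup_sum[of "{e}" J] osup_singleton[of e] by simp
    moreover have "e \<in> S" "osup J \<in> S" using insert by auto
    ultimately show ?case by (rule sub(5)[rotated 2])
  qed
qed

end

text \<open>The atoms of a finite Boolean subalgebra partition the unit: for an atom \<open>e\<close> and any \<open>x\<close> of
  the subalgebra, compatibility leaves only \<open>e \<preceq> x\<close> or \<open>e \<bottom> x\<close>, so every \<open>x\<close> is
  squeezed between the join of the atoms below it and the complement of the join of the others.\<close>

lemma finite_BSub_gen:
  assumes S: "S \<in> BSub A" and fin: "finite S"
  obtains E where "unit_partition E" "E \<subseteq> S" "gen E = S"
proof -
  define E where "E = {e \<in> S. e \<noteq> \<zero> \<and> (\<forall>x\<in>S. x \<preceq> e \<longrightarrow> x = \<zero> \<or> x = e)}"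
  have subS: "subalgebra S A" using S by (simp add: BSub_def)
  note sub = subalgebraD[OF subS]
  have ES: "E \<subseteq> S" by (auto simp: E_def)
  have EA: "E \<subseteq> elems A" using ES sub by blast
  have dich: "e \<preceq> x \<or> e \<bottom> x" if ex: "e \<in> E" "x \<in> S" for e x
  proof -
    have "e \<in> S" using ex ES by blast
    obtain m n k where mnk: "m \<in> S" "n \<in> S" "k \<in> S" "osum A m n = Some e" "osum A m k = Some x" "n \<bottom> x"
      using BSub_compatible[OF S \<open>e \<in> S\<close> ex(2)] .
    have A: "m \<in> elems A" "n \<in> elems A" "k \<in> elems A" using mnk sub(1) by blast+
    have "m \<preceq> e" "m \<preceq> x" using sum_ge mnk A by blast+
    then consider "m = \<zero>" | "m = e" using ex mnk by (auto simp: E_def)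
    then show ?thesis
    proof cases
      case 1
      then have "n = e" using mnk sum_zero[of n] sum_commute[of n \<zero>] A closed by simp
      then show ?thesis using mnk by simp
    qed (use \<open>m \<preceq> x\<close> in simp)
  qed
  have atom: "\<exists>e\<in>E. e \<preceq> x" if x: "x \<in> S" "x \<noteq> \<zero>" for x
  proof -
    let ?R = "\<lambda>a b. a \<preceq> b \<and> a \<noteq> b"
    let ?T = "{y \<in> S. y \<preceq> x \<and> y \<noteq> \<zero>}"
    have "asymp_on ?T ?R" using le_antisym sub(1) by (intro asymp_onI) blast
    moreover have "transp_on ?T ?R" using le_antisym le_trans sub(1) by (intro transp_onI) blast
    moreover have "finite ?T" "?T \<noteq> {}" using fin x le_refl sub(1) by auto
    ultimately obtain e where e: "e \<in> ?T" "\<forall>y\<in>?T. y \<noteq> e \<longrightarrow> \<not> ?R y e"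
      using Finite_Set.bex_min_element[of ?T ?R] by blast
    have "y = \<zero> \<or> y = e" if "y \<in> S" "y \<preceq> e" for y
      using e that le_trans[of y e x] x sub(1) by blast
    then have "e \<in> E" using e by (simp add: E_def)
    then show ?thesis using e by blast
  qed
  have "finite E" using fin ES finite_subset by blast
  have pw: "pairwise (perp A) E"
    using dich ES by (auto simp: pairwise_def E_def)
  have "is_lub E \<one>"
  proof -
    \<comment> \<open>This settles upper bounds in \<open>S\<close> only; the lub of \<open>E\<close> in \<open>A\<close> is therefore shown to lie in \<open>S\<close>.\<close>
    have up: "d = \<one>" if d: "d \<in> S" "\<forall>e\<in>E. e \<preceq> d" for d
    proof (rule ccontr)
      assume "d \<noteq> \<one>"
      have dA: "d \<in> elems A" using d sub(1) by blast
      then have "cmp d \<noteq> \<zero>" using \<open>d \<noteq> \<one>\<close> compl_eq_zero_iff by simp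
      then obtain e where e: "e \<in> E" "e \<preceq> cmp d" using atom d sub(4) by blast
      then have "e \<bottom> d" "e \<preceq> d" using le_compl_iff_perp dA EA d by blast+
      then have "e = \<zero>" using le_perp_zero dA EA e by blast
      then show False using e by (simp add: E_def)
    qed
    have "osup J \<in> S \<and> is_lub J (osup J)" if "J \<subseteq> E" for J
    proof -
      have "finite J" using that \<open>finite E\<close> finite_subset by blast
      then show ?thesis using that
      proof induction
        case empty
        have "is_lub {} \<zero>" using zero_le closed by (auto simp: is_lub_def)
        then show ?case using osup_eqI sub(2) by auto
      next
        case (insert e J)
        have J: "osup J \<in> S" "is_lub J (osup J)" using insert by auto
        have "is_lub (insert e J) (osup (insert e J))"
          using osup_is_lub[of "insert e J"] insert EA pw pairwise_subset[OF pw insert.prems] by blast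
        have eA: "e \<in> elems A" "e \<in> E" "J \<subseteq> E" using insert EA by auto
        have p: "\<forall>x\<in>J. x \<bottom> e" using pw eA insert.hyps by (auto simp: pairwise_def)
        then have "\<forall>x\<in>J. x \<preceq> cmp e" using le_compl_iff_perp eA EA by blast
        then have "osup J \<preceq> cmp e" using J eA closed by (simp add: is_lub_def)
        have JA: "osup J \<in> elems A" using J sub(1) by blast
        then have "osup J \<bottom> e" using le_compl_iff_perp eA \<open>osup J \<preceq> cmp e\<close> by blast
        then obtain t where t: "osum A e (osup J) = Some t" using perpE[OF JA eA(1)] by blast
        then have "is_lub (insert e J) t" using is_lub_insert[OF eA(1) J(2) _ p t] eA EA by blast
        moreover have "t \<in> S" using sub(5)[OF _ J(1) t] eA(2) ES by blast
        ultimately show ?case using osup_eqI by auto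
      qed
    qed
    from this[of E] show ?thesis using up[of "osup E"] by (auto simp: is_lub_def)
  qed
  then have uE: "unit_partition E"
    using \<open>finite E\<close> EA pw by (auto simp: unit_partition_def E_def)
  have "x \<in> gen E" if x: "x \<in> S" for x
  proof -
    let ?J = "{e \<in> E. e \<preceq> x}"
    have xA: "x \<in> elems A" using x sub(1) by blast
    have J: "?J \<subseteq> E" by blast
    note JA = osup_closed[OF uE J]
    have "osup ?J \<preceq> x" by (rule osup_least[OF uE J xA]) blast
    moreover have "osup (E - ?J) \<bottom> x"
      by (rule perp_osup[OF uE _ xA]) (use dich x in blast)+
    then have "osup (E - ?J) \<preceq> cmp x"
      using le_compl_iff_perp[OF osup_closed[OF uE] xA, of "E - ?J"] by blast
    then have "x \<preceq> osup ?J"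
      using compl_antimono[of "cmp (osup ?J)" "cmp x"] osup_compl[OF uE J] xA JA compl_closed compl_compl
      by simp
    ultimately have "x = osup ?J" using le_antisym xA JA by blast
    then show ?thesis using J unfolding gen_def by blast
  qed
  moreover have "gen E \<subseteq> S"
    using osup_in_subalgebra[OF uE subS] ES by (auto simp: gen_def)
  ultimately show ?thesis using that[OF uE ES] by blast
qed

section \<open>Completing and coarsening partitions\<close>

lemma unit_partition_complete:
  assumes F: "finite F" "F \<subseteq> elems A - {\<zero>}" "pairwise (perp A) F" and s: "is_lub F s" "s \<noteq> \<one>"
  shows "unit_partition (insert (cmp s) F)" "cmp s \<notin> F"
proof -
  have le: "f \<preceq> s" if "f \<in> F" for f using s that by (auto simp: is_lub_def)
  have sA: "s \<in> elems A" using s by (simp add: is_lub_def)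
  note cA = compl_closed[OF sA]
  have nz: "cmp s \<noteq> \<zero>" using s(2) compl_eq_zero_iff[OF sA] by simp
  have p: "f \<bottom> cmp s" if "f \<in> F" for f
    using le[OF that] le_iff_perp_compl[of f s] sA F(2) that by blast
  then have p': "cmp s \<bottom> f" if "f \<in> F" for f
    using perp_sym[of f "cmp s"] cA F(2) that by blast
  show notin: "cmp s \<notin> F"
    using p[of "cmp s"] perp_self_iff[OF cA] nz by blast
  have "osum A (cmp s) s = Some \<one>" using sum_compl[OF sA] sum_commute[OF sA cA] by simp
  then have "is_lub (insert (cmp s) F) \<one>"
    using is_lub_insert[OF cA s(1)] F(2) p by blast
  then show "unit_partition (insert (cmp s) F)"
    using F nz cA p p' by (auto simp: unit_partition_def pairwise_insert)
qed

text \<open>Replacing two parts by their join coarsens a partition; the subalgebra loses one degree of height.\<close>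

lemma unit_partition_merge:
  assumes E: "unit_partition E" and xy: "x \<in> E" "y \<in> E" "x \<noteq> y"
  defines "t \<equiv> osup {x, y}"
  shows "unit_partition (insert t (E - {x, y}))" "card (insert t (E - {x, y})) = card E - 1"
    "gen (insert t (E - {x, y})) \<subseteq> gen E"
proof -
  let ?E = "insert t (E - {x, y})"
  have xyE: "{x, y} \<subseteq> E" using xy by simp
  have tA: "t \<in> elems A" using osup_closed[OF E xyE] by (simp add: t_def)
  have up: "x \<preceq> t" "y \<preceq> t" using osup_upper[OF E xyE] by (simp_all add: t_def)
  have xA: "x \<in> elems A" "x \<noteq> \<zero>" "y \<in> elems A" using unit_partition_elems[OF E] xy by simp_all
  have tz: "t \<noteq> \<zero>" using le_zero xA up by blast
  have p: "t \<bottom> f" if "f \<in> E - {x, y}" for f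
    using osup_perp[OF E, of "{x, y}" "{f}"] osup_singleton[OF E, of f] that xy by (simp add: t_def)
  have p': "f \<bottom> t" if "f \<in> E - {x, y}" for f
    using p[OF that] perp_sym[of t f] tA unit_partition_elems[OF E] that by simp
  have notin: "t \<notin> E - {x, y}" using p[of t] perp_self_iff[OF tA] tz by blast
  have "is_lub ?E \<one>"
  proof -
    have "\<one> \<preceq> d" if d: "d \<in> elems A" "\<forall>e\<in>?E. e \<preceq> d" for d
    proof -
      have "x \<preceq> d" "y \<preceq> d" using le_trans[OF _ tA d(1)] up xA d(2) by blast+
      then have "\<forall>e\<in>E. e \<preceq> d" using d(2) by blast
      then show ?thesis using E d(1) by (simp add: unit_partition_def is_lub_def)
    qed
    then show ?thesis using le_one tA unit_partition_elems[OF E] one_closed by (auto simp: is_lub_def)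
  qed
  then show uE: "unit_partition ?E"
    using E tA tz p p' by (auto simp: unit_partition_def pairwise_insert pairwise_def)
  have "card (E - {x, y}) = card E - 2"
    using card_Diff_subset[of "{x, y}" E] xyE xy(3) by simp
  moreover have "card E \<ge> 2"
    using card_mono[OF unit_partition_finite[OF E] xyE] xy(3) by simp
  ultimately show "card ?E = card E - 1" using notin unit_partition_finite[OF E] by simp
  have "?E \<subseteq> gen E"
  proof -
    have "osup {e} \<in> gen E" if "e \<in> E" for e using that by (auto simp: gen_def)
    then have "e \<in> gen E" if "e \<in> E" for e using that osup_singleton[OF E that] by metis
    moreover have "t \<in> gen E" using xyE by (auto simp: t_def gen_def)
    ultimately show ?thesis by blast
  qed
  then show "gen ?E \<subseteq> gen E"
    using osup_in_subalgebra[OF uE gen_subalgebra[OF E]] by (auto simp: gen_def[of ?E])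
qed

lemma zero_neq_one_if_partition:
  assumes "unit_partition E" "E \<noteq> {}" shows "\<zero> \<noteq> \<one>"
  using assms osup_eq_iff[of E "{}" E] osup_empty[of E] osup_whole[of E] by auto

section \<open>Heights of finite Boolean subalgebras\<close>

text \<open>Coarsening one step at a time gives a chain with one member for each number of parts.\<close>

lemma gen_chain:
  assumes "unit_partition E" "E \<noteq> {}"
  shows "\<exists>C. finite C \<and> card C = card E \<and> subset.chain {y \<in> BSub A. y \<subseteq> gen E} C"
  using assms
proof (induction "card E" arbitrary: E rule: less_induct)
  case less
  note E = less.prems(1)
  have fin: "finite E" using unit_partition_finite[OF E] .
  show ?case
  proof (cases "card E = 1")
    case True
    have "subset.chain {y \<in> BSub A. y \<subseteq> gen E} {gen E}"
      using gen_BSub[OF E] by (simp add: subset_chain_def)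
    then show ?thesis using True by (intro exI[of _ "{gen E}"]) simp
  next
    case False
    then obtain x y where xy: "x \<in> E" "y \<in> E" "x \<noteq> y"
      using less.prems(2) fin by (metis card_1_singleton_iff One_nat_def insertCI is_singletonI' is_singleton_altdef)
    define E' where "E' = insert (osup {x, y}) (E - {x, y})"
    note m = unit_partition_merge[OF E xy, folded E'_def]
    have pos: "card E > 0" using less.prems(2) fin by (simp add: card_gt_0_iff)
    then obtain C where C: "finite C" "card C = card E'" "subset.chain {y \<in> BSub A. y \<subseteq> gen E'} C"
      using less.hyps[OF _ m(1)] m(2) by (auto simp: E'_def)
    \<comment> \<open>The inclusion of subalgebras is strict, since their sizes are different powers of two.\<close>
    have "card (gen E') < card (gen E)"
      using card_gen[OF E] card_gen[OF m(1)] m(2) pos by simp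
    then have "\<not> gen E \<subseteq> gen E'" using m(3) by auto
    then have "gen E \<notin> C" using C(3) by (auto simp: subset_chain_def)
    then have "card (insert (gen E) C) = card E" using C(1,2) m(2) pos by simp
    moreover have "subset.chain {y \<in> BSub A. y \<subseteq> gen E} (insert (gen E) C)"
      using C(3) m(3) gen_BSub[OF E] by (fastforce simp: subset_chain_def)
    ultimately show ?thesis using C(1) by blast
  qed
qed

text \<open>The members of a chain have different sizes, and each size is \<open>2 ^ k\<close> with \<open>k\<close> at most the number of
  parts of \<open>E\<close>.  The exponent is never \<open>0\<close>, because \<open>0 \<noteq> 1\<close>.\<close>

lemma chain_card_le:
  assumes E: "unit_partition E" "E \<noteq> {}"
    and C: "finite C" "subset.chain {y \<in> BSub A. y \<subseteq> gen E} C"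
  shows "card C \<le> card E"
proof -
  have finE: "finite (gen E)" using unit_partition_finite[OF E(1)] by (simp add: gen_def)
  have size: "\<exists>k\<in>{1..card E}. card y = 2 ^ k" if "y \<in> C" for y
  proof -
    have y: "y \<in> BSub A" "y \<subseteq> gen E" using that C(2) by (auto simp: subset_chain_def)
    then have "finite y" using finE finite_subset by blast
    then obtain F where F: "unit_partition F" "gen F = y" using finite_BSub_gen y by blast
    have "F \<noteq> {}"
    proof
      assume "F = {}"
      then have "\<zero> = \<one>" using osup_empty[OF F(1)] osup_whole[OF F(1)] by simp
      then show False using zero_neq_one_if_partition[OF E] by simp
    qed
    then have "card F \<ge> 1" using unit_partition_finite[OF F(1)] by (simp add: Suc_le_eq card_gt_0_iff)
    moreover have "(2::nat) ^ card F \<le> 2 ^ card E"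
      using card_mono[OF finE y(2)] card_gen[OF F(1)] card_gen[OF E(1)] F(2) by simp
    ultimately show ?thesis using card_gen[OF F(1)] F(2) by auto
  qed
  have "inj_on card C"
  proof (rule inj_onI)
    fix x y assume xy: "x \<in> C" "y \<in> C" "card x = card y"
    have "finite x" "finite y" "x \<subseteq> y \<or> y \<subseteq> x"
      using xy C(2) finite_subset[OF _ finE] by (auto simp: subset_chain_def)
    then show "x = y" using xy(3) card_subset_eq by metis
  qed
  then have "card C = card (card ` C)" by (simp add: card_image)
  also have "\<dots> \<le> card ((\<lambda>k. 2 ^ k :: nat) ` {1..card E})"
    using size by (intro card_mono) auto
  also have "\<dots> \<le> card E" using card_image_le[of "{1..card E}"] by force
  finally show ?thesis .
qed

lemma height_gen:
  assumes "unit_partition E" "E \<noteq> {}"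
  shows "height_in (BSub A) (gen E) = enat (card E - 1)"
  unfolding height_in_def
proof (rule antisym)
  show "(SUP C\<in>{C. finite C \<and> subset.chain {y \<in> BSub A. y \<subseteq> gen E} C}. enat (card C - 1)) \<le> enat (card E - 1)"
    using chain_card_le[OF assms] by (intro SUP_least) (simp add: diff_le_mono)
  obtain C where "finite C" "card C = card E" "subset.chain {y \<in> BSub A. y \<subseteq> gen E} C"
    using gen_chain[OF assms] by blast
  then show "enat (card E - 1) \<le> (SUP C\<in>{C. finite C \<and> subset.chain {y \<in> BSub A. y \<subseteq> gen E} C}. enat (card C - 1))"
    by (intro SUP_upper2[of C]) auto
qed

section \<open>Points, lines and planes\<close>

definition pt :: "'a \<Rightarrow> 'a set" where
  "pt a = {\<zero>, a, cmp a, \<one>}"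

abbreviation nontrivial :: "'a set" where
  "nontrivial \<equiv> elems A - {\<zero>, \<one>}"

lemma pt_compl: "a \<in> elems A \<Longrightarrow> pt (cmp a) = pt a"
  using compl_compl by (auto simp: pt_def)

lemma compl_nontrivial: "a \<in> nontrivial \<Longrightarrow> cmp a \<in> nontrivial"
  using compl_closed compl_eq_zero_iff compl_eq_one_iff by simp

lemma pt_eq_iff:
  assumes "a \<in> nontrivial" "b \<in> nontrivial" shows "pt a = pt b \<longleftrightarrow> b = a \<or> b = cmp a"
proof
  have "b \<in> pt b" by (simp add: pt_def)
  then show "pt a = pt b \<Longrightarrow> b = a \<or> b = cmp a" using assms by (auto simp: pt_def)
qed (use assms pt_compl in auto)

lemma pt_subset_iff:
  assumes "subalgebra S A" shows "pt a \<subseteq> S \<longleftrightarrow> a \<in> S"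
  using subalgebraD(2-4)[OF assms] by (auto simp: pt_def)

lemma pt_BSub: assumes "a \<in> nontrivial" shows "pt a \<in> BSub A"
proof -
  have l: "is_lub {a} a" using assms le_refl by (simp add: is_lub_def)
  have E: "unit_partition (insert (cmp a) {a})"
    by (rule unit_partition_complete(1)[OF _ _ _ l]) (use assms in auto)
  have "gen (insert (cmp a) {a}) = pt a"
    using osup_empty[OF E] osup_singleton[OF E] osup_whole[OF E]
    by (auto simp: gen_def pt_def Pow_insert)
  then show ?thesis using gen_BSub[OF E] by simp
qed

text \<open>Any nontrivial element of a subalgebra already generates a four-element subalgebra inside it.\<close>

lemma hg_points_eq: "hg_points A = pt ` nontrivial"
proof (intro equalityI subsetI)
  fix p assume p: "p \<in> hg_points A"
  then have B: "p \<in> BSub A" and ne: "p \<noteq> {\<zero>, \<one>}"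
    and min: "\<And>y. y \<in> BSub A \<Longrightarrow> y \<subseteq> p \<Longrightarrow> y = {\<zero>, \<one>} \<or> y = p"
    by (auto simp: hg_points_def)
  have sub: "subalgebra p A" using B by (simp add: BSub_def)
  then obtain a where a: "a \<in> p" "a \<in> nontrivial"
    using ne subalgebraD(1-3)[OF sub] by blast
  then have "pt a = {\<zero>, \<one>} \<or> pt a = p" using min[OF pt_BSub] pt_subset_iff[OF sub] by simp
  moreover have "pt a \<noteq> {\<zero>, \<one>}" using a(2) by (auto simp: pt_def)
  ultimately show "p \<in> pt ` nontrivial" using a(2) by blast
next
  fix p assume "p \<in> pt ` nontrivial"
  then obtain a where a: "a \<in> nontrivial" "p = pt a" by blast
  have "y = {\<zero>, \<one>} \<or> y = pt a" if y: "y \<in> BSub A" "y \<subseteq> pt a" for y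
  proof (cases "y \<subseteq> {\<zero>, \<one>}")
    case True
    then show ?thesis using subalgebraD(2,3)[of y] y by (auto simp: BSub_def)
  next
    case False
    then obtain b where b: "b \<in> y" "b \<noteq> \<zero>" "b \<noteq> \<one>" by blast
    have sub: "subalgebra y A" using y by (simp add: BSub_def)
    have "b = a \<or> b = cmp a" using b y by (auto simp: pt_def)
    then have "pt b = pt a" using pt_compl a by auto
    then show ?thesis using pt_subset_iff[OF sub, of b] b y by auto
  qed
  moreover have "pt a \<noteq> {\<zero>, \<one>}" using a(1) by (auto simp: pt_def)
  ultimately show "p \<in> hg_points A" using pt_BSub[OF a(1)] a(2) by (auto simp: hg_points_def)
qed

lemma points_below_eq:
  assumes "subalgebra S A" shows "{p \<in> hg_points A. p \<subseteq> S} = pt ` (S - {\<zero>, \<one>})"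
  using subalgebraD(1)[OF assms] pt_subset_iff[OF assms] by (auto simp: hg_points_eq)

text \<open>Removing \<open>0\<close> and \<open>1\<close> turns the points below \<open>S\<close> into a partition of the rest of \<open>S\<close> into pairs.\<close>

lemma card_points_below:
  assumes S: "subalgebra S A" and fin: "finite S" and ne: "\<zero> \<noteq> \<one>"
  shows "card S = 2 * card {p \<in> hg_points A. p \<subseteq> S} + 2"
proof -
  let ?N = "S - {\<zero>, \<one>}" and ?f = "\<lambda>a. {a, cmp a}"
  note sub = subalgebraD[OF S]
  have N: "a \<in> nontrivial" if "a \<in> ?N" for a using that sub(1) by blast
  have cN: "cmp a \<in> ?N" if "a \<in> ?N" for a
    using compl_nontrivial[OF N[OF that]] sub(4) that by blast
  have f: "pt a - {\<zero>, \<one>} = ?f a" if "a \<in> ?N" for a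
    using cN[OF that] that by (auto simp: pt_def)
  have "inj_on (\<lambda>p. p - {\<zero>, \<one>}) (pt ` ?N)"
  proof (rule inj_onI)
    fix p q assume "p \<in> pt ` ?N" "q \<in> pt ` ?N" and eq: "p - {\<zero>, \<one>} = q - {\<zero>, \<one>}"
    then have "{\<zero>, \<one>} \<subseteq> p" "{\<zero>, \<one>} \<subseteq> q" by (auto simp: pt_def)
    then show "p = q" using eq Diff_partition by metis
  qed
  then have "card ((\<lambda>p. p - {\<zero>, \<one>}) ` (pt ` ?N)) = card (pt ` ?N)" by (rule card_image)
  moreover have "(\<lambda>p. p - {\<zero>, \<one>}) ` (pt ` ?N) = ?f ` ?N"
    using f by (simp add: image_image)
  ultimately have "card (?f ` ?N) = card (pt ` ?N)" by simp
  moreover have "2 * card (?f ` ?N) = card (\<Union> (?f ` ?N))"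
  proof (rule card_partition)
    fix c assume "c \<in> ?f ` ?N"
    then obtain a where a: "a \<in> ?N" "c = ?f a" by blast
    then have "cmp a \<noteq> a" using compl_neq[of a] N[OF a(1)] by simp
    then show "card c = 2" using a by simp
  next
    fix c1 c2 assume c: "c1 \<in> ?f ` ?N" "c2 \<in> ?f ` ?N" "c1 \<noteq> c2"
    have block: "c = ?f z" if cz: "c \<in> ?f ` ?N" "z \<in> c" for c z
    proof -
      obtain a where a: "a \<in> ?N" "c = ?f a" using cz(1) by blast
      then have "z = a \<or> z = cmp a" "cmp (cmp a) = a" using cz(2) compl_compl N[OF a(1)] by simp_all
      then show ?thesis using a(2) by (metis insert_commute)
    qed
    show "c1 \<inter> c2 = {}" using block[OF c(1)] block[OF c(2)] c(3) by (metis disjoint_iff)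
  qed (use fin in auto)
  moreover have "\<Union> (?f ` ?N) = ?N"
  proof
    have "?f a \<subseteq> ?N" if "a \<in> ?N" for a using cN[OF that] that by simp
    then show "\<Union> (?f ` ?N) \<subseteq> ?N" by (rule UN_least)
  qed auto
  moreover have "card ?N = card S - 2" "card S \<ge> 2"
    using card_Diff_subset[of "{\<zero>, \<one>}" S] card_mono[OF fin, of "{\<zero>, \<one>}"] ne sub(2,3) by simp_all
  ultimately show ?thesis using points_below_eq[OF S] by simp
qed

section \<open>Lines and planes as partitions of the unit\<close>

text \<open>A subalgebra is covered by its points, so having finitely many of them makes it finite, and its size
  then determines the number of its atoms.\<close>

lemma BSub_of_rank:
  assumes x: "x \<in> BSub A" and card: "card {p \<in> hg_points A. p \<subseteq> x} = 2 ^ n - 1" and n: "n > 0"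
  obtains E where "unit_partition E" "card E = Suc n" "gen E = x"
proof -
  let ?P = "{p \<in> hg_points A. p \<subseteq> x}"
  have sub: "subalgebra x A" using x by (simp add: BSub_def)
  have pos: "(2::nat) ^ n \<ge> 2" using n self_le_power[of "2::nat" n] by simp
  then have "?P \<noteq> {}" "finite ?P" using card card_ge_0_finite[of ?P] by (fastforce, simp)
  then obtain a where a: "a \<in> nontrivial" by (auto simp: hg_points_eq)
  then have ne: "\<zero> \<noteq> \<one>" using le_one[of a] le_zero[of a] by auto
  have "x \<subseteq> {\<zero>, \<one>} \<union> \<Union> ?P"
    unfolding points_below_eq[OF sub] by (auto simp: pt_def)
  moreover have "finite p" if "p \<in> ?P" for p using that by (auto simp: hg_points_eq pt_def)
  then have "finite ({\<zero>, \<one>} \<union> \<Union> ?P)" using finite_Union[OF \<open>finite ?P\<close>] by simp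
  ultimately have fin: "finite x" by (rule finite_subset)
  then obtain E where E: "unit_partition E" "gen E = x" using finite_BSub_gen x by blast
  have "(2::nat) ^ card E = 2 ^ Suc n"
    using card_points_below[OF sub fin ne] card card_gen[OF E(1)] E(2) pos by simp
  then have "card E = Suc n" using power_inject_exp[of "2::nat" "card E" "Suc n"] by (simp del: power_Suc)
  then show ?thesis using that E by blast
qed

lemma card_points_gen:
  assumes E: "unit_partition E" "card E = Suc n"
  shows "card {p \<in> hg_points A. p \<subseteq> gen E} = 2 ^ n - 1"
proof -
  have "E \<noteq> {}" using E(2) by force
  then have ne: "\<zero> \<noteq> \<one>" using zero_neq_one_if_partition[OF E(1)] by simp
  have "finite (gen E)" using unit_partition_finite[OF E(1)] by (simp add: gen_def)
  then show ?thesis using card_points_below[OF gen_subalgebra[OF E(1)] _ ne] card_gen[OF E(1)] E(2) by simp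
qed

lemma hg_planes_eq:
  "hg_planes A = {{p \<in> hg_points A. p \<subseteq> gen E} | E. unit_partition E \<and> card E = 4}" (is "_ = ?R")
proof (intro equalityI subsetI)
  fix t assume "t \<in> hg_planes A"
  then obtain x where x: "x \<in> BSub A" "t = {p \<in> hg_points A. p \<subseteq> x}" "card t = 7"
    by (auto simp: hg_planes_def)
  then obtain E where "unit_partition E" "card E = Suc 3" "gen E = x"
    using BSub_of_rank[of x 3] by auto
  then show "t \<in> ?R" using x(2) by auto
next
  fix t assume "t \<in> ?R"
  then obtain E where E: "unit_partition E" "card E = 4" "t = {p \<in> hg_points A. p \<subseteq> gen E}" by blast
  then have "card t = 7" using card_points_gen[of E 3] by simp
  moreover have "E \<noteq> {}" using E(2) by auto
  then have "height_in (BSub A) (gen E) = 3"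
    using height_gen[OF E(1)] E(2) by (simp add: numeral_eq_enat)
  ultimately show "t \<in> hg_planes A" using gen_BSub[OF E(1)] E(3) by (auto simp: hg_planes_def)
qed

lemma unit_partition_nontrivial:
  assumes E: "unit_partition E" "card E \<ge> 2" "e \<in> E" shows "e \<in> nontrivial"
proof -
  have "{e} \<noteq> E" using E(2) by auto
  then have "e \<noteq> \<one>"
    using osup_eq_iff[OF E(1), of "{e}" E] osup_whole[OF E(1)] osup_singleton[OF E(1,3)] E(3) by auto
  then show ?thesis using unit_partition_elems[OF E(1,3)] by simp
qed

text \<open>Distinct parts with the same point are complementary, and then there are no other parts.\<close>

lemma pt_inj_on_partition:
  assumes E: "unit_partition E" "card E \<ge> 3" shows "inj_on pt E"
proof (rule inj_onI, rule ccontr)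
  fix e f assume ef: "e \<in> E" "f \<in> E" "pt e = pt f" "e \<noteq> f"
  have "f = cmp e" using pt_eq_iff[of e f] unit_partition_nontrivial[OF E(1)] E(2) ef by simp
  then have "osup {f} = osup (E - {e})"
    using osup_compl[OF E(1), of "{e}"] osup_singleton[OF E(1)] ef by simp
  then have "E - {e} = {f}" using osup_eq_iff[OF E(1), of "{f}" "E - {e}"] ef by auto
  then have "E = {e, f}" using ef by auto
  then have "card E = 2" using ef(4) by simp
  then show False using E(2) by simp
qed

lemma partition_subset_gen:
  assumes E: "unit_partition E" shows "E \<subseteq> gen E"
proof
  fix e assume e: "e \<in> E"
  then have "osup {e} \<in> gen E" by (auto simp: gen_def)
  then show "e \<in> gen E" using osup_singleton[OF E e] by simp
qed

text \<open>With three parts, every nontrivial join is a part or the complement of a part, so the parts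
  represent all points of the subalgebra.\<close>

lemma hg_lines_eq: "hg_lines A = {pt ` E | E. unit_partition E \<and> card E = 3}" (is "_ = ?R")
proof -
  have below: "{p \<in> hg_points A. p \<subseteq> gen E} = pt ` E" if E: "unit_partition E" "card E = 3" for E
  proof -
    have "e \<in> gen E - {\<zero>, \<one>}" if "e \<in> E" for e
      using unit_partition_nontrivial[OF E(1) _ that] partition_subset_gen[OF E(1)] E(2) that by auto
    then have "pt ` E \<subseteq> {p \<in> hg_points A. p \<subseteq> gen E}"
      unfolding points_below_eq[OF gen_subalgebra[OF E(1)]] by blast
    moreover have "card (pt ` E) = 3" using pt_inj_on_partition[OF E(1)] E(2) by (simp add: card_image)
    moreover have c: "card {p \<in> hg_points A. p \<subseteq> gen E} = 3" using card_points_gen[of E 2] E by simp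
    moreover have "finite {p \<in> hg_points A. p \<subseteq> gen E}" by (rule card_ge_0_finite) (simp add: c)
    ultimately show ?thesis using card_subset_eq[of "{p \<in> hg_points A. p \<subseteq> gen E}" "pt ` E"] by simp
  qed
  show ?thesis
  proof (intro equalityI subsetI)
    fix l assume "l \<in> hg_lines A"
    then obtain x where x: "x \<in> BSub A" "l = {p \<in> hg_points A. p \<subseteq> x}" "card l = 3"
      by (auto simp: hg_lines_def)
    then obtain E where E: "unit_partition E" "card E = Suc 2" "gen E = x"
      using BSub_of_rank[of x 2] by auto
    then show "l \<in> ?R" using below[of E] x(2) by auto
  next
    fix l assume "l \<in> ?R"
    then obtain E where E: "unit_partition E" "card E = 3" "l = {p \<in> hg_points A. p \<subseteq> gen E}"
      using below by blast
    then have "card l = 3" using card_points_gen[of E 2] by simp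
    moreover have "E \<noteq> {}" using E(2) by auto
    then have "height_in (BSub A) (gen E) = 2"
      using height_gen[OF E(1)] E(2) by (simp add: numeral_eq_enat)
    ultimately show "l \<in> hg_lines A" using gen_BSub[OF E(1)] E(3) by (auto simp: hg_lines_def)
  qed
qed

text \<open>The parts of the partition behind a line, in the order in which its points are listed.\<close>

lemma line_coords:
  assumes "{p, q, m} \<in> hg_lines A"
  obtains a b c where "a \<in> nontrivial" "b \<in> nontrivial" "c \<in> nontrivial"
    "p = pt a" "q = pt b" "m = pt c" "osum A a b = Some (cmp c)"
proof -
  obtain E where E: "unit_partition E" "card E = 3" "pt ` E = {p, q, m}"
    using assms by (auto simp: hg_lines_eq)
  have "p \<in> pt ` E" "q \<in> pt ` E" "m \<in> pt ` E" by (simp_all add: E(3))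
  then obtain a b c where abc: "a \<in> E" "b \<in> E" "c \<in> E" "p = pt a" "q = pt b" "m = pt c"
    by (elim imageE) simp
  have "card {p, q, m} = 3"
    using card_image[OF pt_inj_on_partition[OF E(1)]] E(2,3) by simp
  then have d: "a \<noteq> b" "a \<noteq> c" "b \<noteq> c" using abc by (auto simp: card_insert_if split: if_splits)
  have "{a, b, c} = E"
    using card_subset_eq[of E "{a, b, c}"] unit_partition_finite[OF E(1)] E(2) abc d by simp
  then have "E - {c} = {a, b}" using d by auto
  then have "osum A a b = Some (cmp c)"
    using osup_sum[OF E(1), of "{a}" "{b}"] osup_singleton[OF E(1)] osup_compl[OF E(1), of "{c}"] abc d
    by (simp add: insert_commute)
  then show ?thesis
    using that[of a b c] abc unit_partition_nontrivial[OF E(1)] E(2) by simp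
qed

text \<open>Two points of a line determine the third: the orthogonal sum of two parts is the complement of the third.\<close>

lemma line_closed:
  assumes l: "{p, q, m} \<in> hg_lines A" and S: "subalgebra S A" "p \<subseteq> S" "q \<subseteq> S"
  shows "m \<subseteq> S"
proof -
  note sub = subalgebraD[OF S(1)]
  obtain a b c where c: "c \<in> nontrivial" "p = pt a" "q = pt b" "m = pt c" "osum A a b = Some (cmp c)"
    using line_coords[OF l] by metis
  have "a \<in> S" "b \<in> S" using S c pt_subset_iff[OF S(1)] by simp_all
  then have "cmp c \<in> S" using sub(5) c(5) by blast
  then have "c \<in> S" using sub(4)[of "cmp c"] compl_compl c(1) by simp
  then show ?thesis using c pt_subset_iff[OF S(1)] by simp
qed

lemma lines_sub_points: "l \<in> hg_lines A \<Longrightarrow> l \<subseteq> hg_points A"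
  by (auto simp: hg_lines_def)

end

text \<open>A triangle \<open>p, q, r\<close> with third points \<open>m, n, k\<close> on its sides, and the third point \<open>s\<close> of the line
  joining the vertex \<open>p\<close> to the point \<open>k\<close> on the opposite side.  The cardinality makes all seven points
  distinct.  Only three-element sets of points are tested for membership in \<open>L\<close>, so the notion is
  preserved by any bijection of points that preserves lines.\<close>

definition plane_figure :: "'b set set \<Rightarrow> 'b set \<Rightarrow> bool" where
  "plane_figure L X \<longleftrightarrow> card X = 7 \<and> (\<exists>p q r s m n k. X = {p, q, r, s, m, n, k} \<and>
     {p, q, m} \<in> L \<and> {p, r, n} \<in> L \<and> {q, r, k} \<in> L \<and> {p, s, k} \<in> L)"

context orthomodular_poset
begin

text \<open>The vertices are three of the parts \<open>a, b, c, d\<close>.  The line through \<open>pt a\<close> and \<open>pt b\<close> comes from joining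
  \<open>c\<close> and \<open>d\<close> to one part; as \<open>c \<oplus> d\<close> is the complement of \<open>a \<oplus> b\<close>, its third point is the same for
  \<open>a, b\<close> as for \<open>c, d\<close>.\<close>

lemma plane_imp_figure:
  assumes "X \<in> hg_planes A" shows "plane_figure (hg_lines A) X"
proof -
  obtain E where E: "unit_partition E" "card E = 4" "X = {p \<in> hg_points A. p \<subseteq> gen E}"
    using assms by (auto simp: hg_planes_eq)
  then obtain a b c d where abcd: "E = {a, b, c, d}"
      "a \<noteq> b" "a \<noteq> c" "a \<noteq> d" "b \<noteq> c" "b \<noteq> d" "c \<noteq> d"
    by (auto simp: numeral_eq_Suc card_Suc_eq)
  have line: "{pt x, pt y, pt (osup {z, w})} \<in> hg_lines A"
    if "E = {x, y, z, w}" "z \<noteq> w" "z \<noteq> x" "z \<noteq> y" "w \<noteq> x" "w \<noteq> y" for x y z w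
  proof -
    have "E - {z, w} = {x, y}" using that by auto
    then have "unit_partition {osup {z, w}, x, y}" "card {osup {z, w}, x, y} = 3"
      using unit_partition_merge(1,2)[OF E(1), of z w] E(2) that(1,2) by simp_all
    then have "pt ` {osup {z, w}, x, y} \<in> hg_lines A" unfolding hg_lines_eq by blast
    then show ?thesis by (simp add: insert_commute)
  qed
  have compl: "pt (osup J) = pt (osup K)" if "J \<union> K = E" "J \<inter> K = {}" for J K
  proof -
    have "J \<subseteq> E" "K = E - J" using that by auto
    then show ?thesis using osup_compl[OF E(1)] pt_compl[OF osup_closed[OF E(1)]] by simp
  qed
  have mid: "pt (osup {a, b}) = pt (osup {c, d})" "pt (osup {a, c}) = pt (osup {b, d})"
    "pt (osup {b, c}) = pt (osup {a, d})"
    by (rule compl; use abcd in auto)+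
  have sing: "osup {a} = a" "osup {b} = b" "osup {c} = c" "osup {d} = d"
    using osup_singleton[OF E(1)] abcd(1) by simp_all
  have "pt (osup {b, c, d}) = pt (osup {a})" "pt (osup {a, c, d}) = pt (osup {b})"
    "pt (osup {a, b, d}) = pt (osup {c})" "pt (osup {a, b, c}) = pt (osup {d})"
    by (rule compl; use abcd in auto)+
  note triple = this[unfolded sing]
  let ?Y = "{pt a, pt b, pt c, pt d, pt (osup {c, d}), pt (osup {b, d}), pt (osup {a, d})}"
  have "X \<subseteq> ?Y"
  proof
    fix p assume "p \<in> X"
    then have "p \<in> pt ` (gen E - {\<zero>, \<one>})"
      using E(3) points_below_eq[OF gen_subalgebra[OF E(1)]] by simp
    then obtain J where J: "J \<subseteq> E" "p = pt (osup J)" "osup J \<noteq> \<zero>" "osup J \<noteq> \<one>"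
      by (auto simp: gen_def)
    then have ne: "J \<noteq> {}" "J \<noteq> {a, b, c, d}"
      using osup_empty[OF E(1)] osup_whole[OF E(1)] abcd(1) by auto
    have "J \<in> Pow {a, b, c, d}" using J(1) abcd(1) by simp
    then show "p \<in> ?Y" unfolding J(2) using ne
      by (simp only: Pow_insert Pow_empty image_insert image_empty Un_insert_left Un_empty_left)
        (elim insertE; simp add: mid sing triple)
  qed
  moreover have X7: "card X = 7" using assms by (simp add: hg_planes_def)
  moreover have "card ?Y \<le> 7"
    using card_length[of "[pt a, pt b, pt c, pt d, pt (osup {c, d}), pt (osup {b, d}), pt (osup {a, d})]"]
    by simp
  ultimately have "X = ?Y" by (intro card_seteq) simp_all
  moreover have "{pt a, pt b, pt (osup {c, d})} \<in> hg_lines A" "{pt a, pt c, pt (osup {b, d})} \<in> hg_lines A"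
    "{pt b, pt c, pt (osup {a, d})} \<in> hg_lines A" "{pt a, pt d, pt (osup {b, c})} \<in> hg_lines A"
    by (rule line; use abcd in auto)+
  ultimately show ?thesis using X7 mid(3) unfolding plane_figure_def by metis
qed

section \<open>Triangles span planes\<close>

text \<open>Since \<open>s\<close> is the join of \<open>x\<close> and \<open>y\<close>, it is orthogonal to \<open>z\<close>, so the three elements have a joint sum,
  whose complement is the fourth part.  This is where orthomodularity is essential; \<open>z \<noteq> s'\<close> says that the
  three elements do not already fill up the unit, that is, do not come from a line.\<close>

lemma orth_triple_partition:
  assumes xyz: "x \<in> elems A" "y \<in> elems A" "z \<in> elems A" "x \<noteq> \<zero>" "y \<noteq> \<zero>" "z \<noteq> \<zero>"
    and p: "x \<bottom> z" "y \<bottom> z" and s: "osum A x y = Some s" and ns: "z \<noteq> cmp s"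
  obtains E where "unit_partition E" "card E = 4" "{x, y, z} \<subseteq> E"
proof -
  have sA: "s \<in> elems A" using sum_closed xyz s by blast
  have sz: "s \<bottom> z"
    using sum_least[OF xyz(1,2) s, of "cmp z"] compl_closed[OF xyz(3)] p le_compl_iff_perp sA xyz by simp
  obtain t where t: "osum A z s = Some t" using perpE[OF sA xyz(3) sz] by blast
  have "is_lub {x, y} s"
    using sum_ge[OF xyz(1,2) s] sum_least[OF xyz(1,2) s] sA by (simp add: is_lub_def)
  then have l: "is_lub {z, x, y} t"
    using is_lub_insert[OF xyz(3) _ _ _ t] p xyz by simp
  have tu: "t \<noteq> \<one>"
  proof
    assume "t = \<one>"
    then have "s = cmp z" using compl_unique[OF xyz(3) sA] t by simp
    then show False using ns compl_compl[OF xyz(3)] by simp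
  qed
  have xy: "x \<bottom> y" using s by (simp add: perp_def)
  have d: "x \<noteq> y" "x \<noteq> z" "y \<noteq> z" using xy p perp_self_iff xyz by blast+
  have pw: "pairwise (perp A) {z, x, y}"
    using xy p perp_sym[OF xyz(1,2) xy] perp_sym[OF xyz(1,3) p(1)] perp_sym[OF xyz(2,3) p(2)]
    by (auto simp: pairwise_insert)
  note E = unit_partition_complete[OF _ _ pw l tu]
  show ?thesis using that[of "insert (cmp t) {z, x, y}"] E xyz d by simp
qed

text \<open>The parts are \<open>x\<close>, the difference \<open>d\<close> of \<open>y\<close> and \<open>x\<close>, the element \<open>z\<close>, and what is left of the unit.\<close>

lemma chain_partition:
  assumes xyz: "x \<in> nontrivial" "y \<in> nontrivial" "z \<in> nontrivial"
    and le: "x \<preceq> y" "x \<noteq> y" and yz: "y \<bottom> z" "z \<noteq> cmp y"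
  obtains E where "unit_partition E" "card E = 4" "{x, y, z} \<subseteq> gen E"
proof -
  obtain d where d: "d \<in> elems A" "osum A x d = Some y" using le(1) by (auto simp: oa_le_def)
  have dz: "d \<noteq> \<zero>" using d(2) sum_zero[of x] xyz le(2) by auto
  have e: "x \<in> elems A" "y \<in> elems A" "z \<in> elems A" "x \<noteq> \<zero>" "z \<noteq> \<zero>" using xyz by simp_all
  have "d \<preceq> y" using sum_ge[OF e(1) d] by simp
  then have "x \<bottom> z" "d \<bottom> z" using perp_mono e d(1) le(1) yz(1) by blast+
  then obtain E where E: "unit_partition E" "card E = 4" "{x, d, z} \<subseteq> E"
    using orth_triple_partition[OF e(1) d(1) e(3,4) dz e(5) _ _ d(2) yz(2)] by blast
  then have g: "{x, d, z} \<subseteq> gen E" using partition_subset_gen by blast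
  then have "y \<in> gen E" using subalgebraD(5)[OF gen_subalgebra[OF E(1)] _ _ d(2)] by simp
  then show ?thesis using that[OF E(1,2)] g by simp
qed

text \<open>Write \<open>a, b\<close> for the elements picked by the first line at \<open>p, q\<close>, then \<open>a2, c\<close> for those picked by the
  second line at \<open>p, r\<close>, and \<open>b2, c2\<close> for those picked by the third line at \<open>q, r\<close>.  The named cases list
  the vertices at which two lines pick complementary elements: none gives an orthogonal triple, one gives a
  chain below an orthocomplement, and more are impossible.\<close>

lemma triangle_partition:
  assumes l: "{p, q, m} \<in> hg_lines A" "{p, r, n} \<in> hg_lines A" "{q, r, k} \<in> hg_lines A"
    and d: "p \<noteq> q" "p \<noteq> r" "q \<noteq> r" "r \<noteq> m"
  obtains E where "unit_partition E" "card E = 4" "p \<subseteq> gen E" "q \<subseteq> gen E" "r \<subseteq> gen E"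
proof -
  obtain a b w where ab: "a \<in> nontrivial" "b \<in> nontrivial" "w \<in> nontrivial"
    "p = pt a" "q = pt b" "m = pt w" "osum A a b = Some (cmp w)" using line_coords[OF l(1)] .
  obtain a2 c where ac: "a2 \<in> nontrivial" "c \<in> nontrivial" "p = pt a2" "r = pt c" "a2 \<bottom> c"
    using line_coords[OF l(2)] unfolding perp_def by (metis option.distinct(1))
  obtain b2 c2 where bc: "b2 \<in> nontrivial" "c2 \<in> nontrivial" "q = pt b2" "r = pt c2" "b2 \<bottom> c2"
    using line_coords[OF l(3)] unfolding perp_def by (metis option.distinct(1))
  have a2: "a2 = a \<or> a2 = cmp a" and b2: "b2 = b \<or> b2 = cmp b" and c2: "c2 = c \<or> c2 = cmp c"
    using pt_eq_iff[OF ab(1) ac(1)] pt_eq_iff[OF ab(2) bc(1)] pt_eq_iff[OF ac(2) bc(2)] ab ac bc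
    by simp_all
  have e: "a \<in> elems A" "b \<in> elems A" "c \<in> elems A" "a \<noteq> \<zero>" "b \<noteq> \<zero>" "c \<noteq> \<zero>"
    using ab ac by simp_all
  note ce = compl_closed[OF e(1)] compl_closed[OF e(2)] compl_closed[OF e(3)]
  have abp: "a \<bottom> b" using ab(7) by (simp add: perp_def)
  have ba: "b \<bottom> a" using perp_sym[OF e(1,2) abp] .
  have ne: "a \<noteq> b" "a \<noteq> c" "b \<noteq> c" "b \<noteq> cmp a" "a \<noteq> cmp b" "c \<noteq> cmp a" "a \<noteq> cmp c" "b \<noteq> cmp c"
    using d ab ac pt_compl[OF e(1)] pt_compl[OF e(2)] pt_compl[OF e(3)] by auto
  have "\<exists>E. unit_partition E \<and> card E = 4 \<and> {a, b, c} \<subseteq> gen E"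
  proof -
    consider (same) "a2 = a" "b2 = b" "c2 = c" | (a) "a2 = cmp a" "b2 = b" "c2 = c"
      | (b) "a2 = a" "b2 = cmp b" "c2 = c" | (c) "a2 = a" "b2 = b" "c2 = cmp c"
      | (ab) "a2 = cmp a" "b2 = cmp b" "c2 = c" | (ac) "a2 = cmp a" "b2 = b" "c2 = cmp c"
      | (bc) "a2 = a" "b2 = cmp b" "c2 = cmp c" | (abc) "a2 = cmp a" "b2 = cmp b" "c2 = cmp c"
      using a2 b2 c2 by blast
    then show ?thesis
    proof cases
      case same
      have "c \<noteq> cmp (cmp w)" using compl_compl ab(3,6) ac(4) d(4) by auto
      then obtain E where "unit_partition E" "card E = 4" "{a, b, c} \<subseteq> E"
        using orth_triple_partition[OF e _ _ ab(7)] ac(5) bc(5) same by blast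
      then show ?thesis using partition_subset_gen by blast
    next
      case a
      then have "c \<preceq> a" using ac(5) perp_sym[OF ce(1) e(3)] le_iff_perp_compl[OF e(3,1)] by simp
      then show ?thesis
        using chain_partition[OF ac(2) ab(1) ab(2) _ _ abp ne(4)] ne(2) by (metis insert_commute)
    next
      case b
      then have "c \<preceq> b" using bc(5) perp_sym[OF ce(2) e(3)] le_iff_perp_compl[OF e(3,2)] by simp
      then show ?thesis
        using chain_partition[OF ac(2) ab(2) ab(1) _ _ ba ne(5)] ne(3) by (metis insert_commute)
    next
      case c
      then have "b \<preceq> c" using bc(5) le_iff_perp_compl[OF e(2,3)] by simp
      moreover have "c \<bottom> a" using ac(5) c perp_sym[OF e(1,3)] by simp
      ultimately show ?thesis
        using chain_partition[OF ab(2) ac(2) ab(1) _ ne(3) _ ne(7)] by (metis insert_commute)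
    next
      \<comment> \<open>Disagreement at two vertices puts a nonzero element below one that it is orthogonal to.\<close>
      case ab
      then have "c \<preceq> a" "c \<preceq> b"
        using ac(5) bc(5) perp_sym[OF ce(1) e(3)] perp_sym[OF ce(2) e(3)]
          le_iff_perp_compl[OF e(3,1)] le_iff_perp_compl[OF e(3,2)] by simp_all
      then have "c = \<zero>" using perp_mono[OF e(3,1,2) _ abp] le_perp_zero[OF e(3,2)] by simp
      then show ?thesis using e by simp
    next
      case ac
      then have "c \<preceq> a" "b \<preceq> c"
        using \<open>a2 \<bottom> c\<close> bc(5) perp_sym[OF ce(1) e(3)]
          le_iff_perp_compl[OF e(3,1)] le_iff_perp_compl[OF e(2,3)] by simp_all
      then have "b \<preceq> a" using le_trans[OF e(2,3,1)] by simp
      then have "b = \<zero>" using le_perp_zero[OF e(2,1) _ ba] by simp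
      then show ?thesis using e by simp
    next
      case bc
      then have "cmp b \<preceq> c" "a \<preceq> cmp b" "a \<bottom> c"
        using \<open>a2 \<bottom> c\<close> \<open>b2 \<bottom> c2\<close> abp le_compl_iff_perp[OF e(1,2)] le_iff_perp_compl[OF ce(2) e(3)] by simp_all
      then have "a = \<zero>" using le_trans[OF e(1) ce(2) e(3)] le_perp_zero[OF e(1,3)] by simp
      then show ?thesis using e by simp
    next
      \<comment> \<open>Here \<open>c \<preceq> a \<preceq> b' \<preceq> c\<close>, so two of the vertices coincide.\<close>
      case abc
      then have "cmp b \<preceq> c" "a \<preceq> cmp b" "c \<preceq> a"
        using \<open>a2 \<bottom> c\<close> \<open>b2 \<bottom> c2\<close> abp le_compl_iff_perp[OF e(1,2)] le_iff_perp_compl[OF ce(2) e(3)]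
          perp_sym[OF ce(1) e(3)] le_iff_perp_compl[OF e(3,1)] by simp_all
      then have "a = c" using le_trans[OF e(1) ce(2) e(3)] le_antisym[OF e(1,3)] by simp
      then show ?thesis using ne by simp
    qed
  qed
  then obtain E where E: "unit_partition E" "card E = 4" "{a, b, c} \<subseteq> gen E" by blast
  show ?thesis
    by (rule that[OF E(1,2)]) (use pt_subset_iff[OF gen_subalgebra[OF E(1)]] E(3) ab(4,5) ac(4) in simp_all)
qed

lemma figure_imp_plane:
  assumes "plane_figure (hg_lines A) X" shows "X \<in> hg_planes A"
proof -
  obtain p q r s m n k where X: "X = {p, q, r, s, m, n, k}" and X7: "card X = 7"
    and l: "{p, q, m} \<in> hg_lines A" "{p, r, n} \<in> hg_lines A" "{q, r, k} \<in> hg_lines A"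
      "{p, s, k} \<in> hg_lines A"
    using assms unfolding plane_figure_def by blast
  have "distinct [p, q, r, s, m, n, k]"
    using X7 X by (intro card_distinct) simp
  then have d: "p \<noteq> q" "p \<noteq> r" "q \<noteq> r" "r \<noteq> m" by auto
  obtain E where E: "unit_partition E" "card E = 4" "p \<subseteq> gen E" "q \<subseteq> gen E" "r \<subseteq> gen E"
    using triangle_partition[OF l(1-3) d] .
  note cl = line_closed[OF _ gen_subalgebra[OF E(1)]]
  have mnk: "m \<subseteq> gen E" "n \<subseteq> gen E" "k \<subseteq> gen E"
    using cl[OF l(1) E(3,4)] cl[OF l(2) E(3,5)] cl[OF l(3) E(4,5)] .
  \<comment> \<open>The last point is reached along the line from \<open>p\<close> to \<open>k\<close>, both already in the subalgebra.\<close>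
  have "s \<subseteq> gen E" using cl[of p k s] l(4) E(3) mnk(3) by (simp add: insert_commute)
  moreover have "X \<subseteq> hg_points A" using l[THEN lines_sub_points] X by simp
  ultimately have "X \<subseteq> {p \<in> hg_points A. p \<subseteq> gen E}" using X E mnk by auto
  moreover have c: "card {p \<in> hg_points A. p \<subseteq> gen E} = 7" using card_points_gen[of E 3] E by simp
  moreover have "finite {p \<in> hg_points A. p \<subseteq> gen E}" by (rule card_ge_0_finite) (simp add: c)
  ultimately have "X = {p \<in> hg_points A. p \<subseteq> gen E}"
    using X7 card_subset_eq[of "{p \<in> hg_points A. p \<subseteq> gen E}" X] by simp
  then show ?thesis using E(1,2) by (auto simp: hg_planes_eq)
qed

lemma hg_planes_iff_figure: "X \<in> hg_planes A \<longleftrightarrow> plane_figure (hg_lines A) X"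
  using plane_imp_figure figure_imp_plane by blast

end

section \<open>Bijections that preserve lines\<close>

lemma plane_figure_image_iff:
  assumes inj: "inj_on \<sigma> P"
    and lines: "\<And>Y. Y \<subseteq> P \<Longrightarrow> Y \<in> L \<longleftrightarrow> \<sigma> ` Y \<in> M"
    and X: "X \<subseteq> P"
  shows "plane_figure L X \<longleftrightarrow> plane_figure M (\<sigma> ` X)"
proof -
  have card: "card (\<sigma> ` X) = card X" using card_image[OF inj_on_subset[OF inj X]] .
  have img: "{\<sigma> x, \<sigma> y, \<sigma> z} \<in> M \<longleftrightarrow> {x, y, z} \<in> L" if "x \<in> X" "y \<in> X" "z \<in> X" for x y z
    using lines[of "{x, y, z}"] that X by auto
  show ?thesis
  proof
    assume "plane_figure L X"
    then obtain p q r s m n k where c: "X = {p, q, r, s, m, n, k}" "{p, q, m} \<in> L" "{p, r, n} \<in> L"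
        "{q, r, k} \<in> L" "{p, s, k} \<in> L" "card X = 7"
      unfolding plane_figure_def by blast
    have im: "\<sigma> ` X = {\<sigma> p, \<sigma> q, \<sigma> r, \<sigma> s, \<sigma> m, \<sigma> n, \<sigma> k}" using c(1) by simp
    have "{\<sigma> p, \<sigma> q, \<sigma> m} \<in> M" "{\<sigma> p, \<sigma> r, \<sigma> n} \<in> M" "{\<sigma> q, \<sigma> r, \<sigma> k} \<in> M" "{\<sigma> p, \<sigma> s, \<sigma> k} \<in> M"
      using c by (simp_all add: img)
    moreover have "card (\<sigma> ` X) = 7" using card c(6) by simp
    ultimately show "plane_figure M (\<sigma> ` X)"
      unfolding plane_figure_def using im by blast
  next
    assume "plane_figure M (\<sigma> ` X)"
    then obtain p' q' r' s' m' n' k' where c': "\<sigma> ` X = {p', q', r', s', m', n', k'}" "{p', q', m'} \<in> M"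
        "{p', r', n'} \<in> M" "{q', r', k'} \<in> M" "{p', s', k'} \<in> M" "card X = 7"
      unfolding plane_figure_def card by blast
    have "p' \<in> \<sigma> ` X" "q' \<in> \<sigma> ` X" "r' \<in> \<sigma> ` X" "s' \<in> \<sigma> ` X" "m' \<in> \<sigma> ` X" "n' \<in> \<sigma> ` X" "k' \<in> \<sigma> ` X"
      by (simp_all add: c'(1))
    then obtain p q r s m n k where x: "p \<in> X" "p' = \<sigma> p" "q \<in> X" "q' = \<sigma> q" "r \<in> X" "r' = \<sigma> r"
        "s \<in> X" "s' = \<sigma> s" "m \<in> X" "m' = \<sigma> m" "n \<in> X" "n' = \<sigma> n" "k \<in> X" "k' = \<sigma> k"
      by (elim imageE) simp
    then have "\<sigma> ` X = \<sigma> ` {p, q, r, s, m, n, k}" using c'(1) by simp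
    moreover have "{p, q, r, s, m, n, k} \<subseteq> P" using x(1,3,5,7,9,11,13) X by (simp add: subset_iff)
    ultimately have "X = {p, q, r, s, m, n, k}"
      using inj_on_image_eq_iff[OF inj X] by blast
    moreover have "{p, q, m} \<in> L" "{p, r, n} \<in> L" "{q, r, k} \<in> L" "{p, s, k} \<in> L"
      using c' x img by simp_all
    ultimately show "plane_figure L X" using c'(6) unfolding plane_figure_def by blast
  qed
qed

theorem theorem6p8:
  fixes A :: "'a orthoalg" and C :: "'b orthoalg" and \<sigma> :: "'a set \<Rightarrow> 'b set"
  assumes "orthomodular_poset A" and "orthomodular_poset C"
    and "bij_betw \<sigma> (hg_points A) (hg_points C)"
    and "\<forall>X. X \<subseteq> hg_points A \<longrightarrow> (X \<in> hg_lines A \<longleftrightarrow> \<sigma> ` X \<in> hg_lines C)"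
  shows "\<forall>X. X \<subseteq> hg_points A \<longrightarrow> (X \<in> hg_planes A \<longleftrightarrow> \<sigma> ` X \<in> hg_planes C)"
proof (intro allI impI)
  fix X assume X: "X \<subseteq> hg_points A"
  have "plane_figure (hg_lines A) X \<longleftrightarrow> plane_figure (hg_lines C) (\<sigma> ` X)"
    using plane_figure_image_iff[of \<sigma> "hg_points A" "hg_lines A" "hg_lines C" X] assms(3,4) X
    by (auto simp: bij_betw_def)
  then show "X \<in> hg_planes A \<longleftrightarrow> \<sigma> ` X \<in> hg_planes C"
    using orthomodular_poset.hg_planes_iff_figure[OF assms(1)]
      orthomodular_poset.hg_planes_iff_figure[OF assms(2)] by simp
qed

end
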